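(* Let $S\ge2$, $L$, $m$, $n_B$ be positive integers, let $P_1,\dots,P_S$ be types of sequences in $\mathcal X^m$, let $\epsilon\in(0,1)$, $\tau\in(0,\epsilon)$, $\zeta>0$, and let $h_\ell:\mathcal X^{(\ell-1)m}\times\mathcal Y^{(\ell-1)m}\times\mathcal Y^{(\ell-1)m}\to\{1,\dots,S\}$, $\ell=1,\dots,L$, be arbitrary mappings. Let $\mathbb x$ be any element of $$\mathbb F=\{\mathbb x\in\mathcal X^{SLm}:\ \mathbb x_\ell(s)\text{ has type }P_s\ \ \forall s\in\{1,\dots,S\},\ \forall \ell\in\{1,\dots,L\}\}.$$ Then $$\log M^*_{\mathrm f}\big(Lm+n_B,\ \epsilon+\epsilon^*(n_B,S^L)\big)\ \ge\ \sup\Big\{\gamma:\ \max_{k}\mathbb P\big[\imath_k(\mathbb x^L(B^L);\mathbb Y_k^L(B^L))\le\gamma\big]<\epsilon-\tau-e^{-\zeta}\Big\}+\log\frac\tau2-SL|\mathcal X|\log(1+m)-L\log S-\zeta,$$ where the probability is under the distribution $\mathbb P_{\mathbb Y_1,\mathbb Y_2,B^L}$ defined below.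
   Context: Setting (CM-DMBC): finite alphabets $\mathcal X=\{1,\dots,N\}$, $\mathcal Y$; transition matrices $W_1,W_2$; given input $x$ the two outputs are $(y_1,y_2)$ with probability $W_1(y_1|x)W_2(y_2|x)$, memoryless. $\imath_{P,W_k}(x;y)=\log\frac{W_k(y|x)}{PW_k(y)}$ with $PW_k(y)=\sum_xP(x)W_k(y|x)$. An $(n,M,\epsilon)$-FLF code: encoders $f_i:\{1,\dots,M\}\times\mathcal Y^{i-1}\times\mathcal Y^{i-1}\to\mathcal X$ (possibly randomized), $X_i=f_i(J,Y_1^{i-1},Y_2^{i-1})$ with $J$ uniform on $\{1,\dots,M\}$; decoders $g_k:\mathcal Y^n\to\{1,\dots,M\}$ with $\mathbb P[g_k(Y_k^n)\ne J]\le\epsilon$, $k=1,2$. $M^*_{\mathrm f}(n,\epsilon)$ is the largest $M$ for which an $(n,M,\epsilon)$-FLF code exists. $\epsilon^*(n_B,S^L)$ is the smallest $\epsilon$ such that there exists a fixed-length no-feedback code for the CM-DMBC of blocklength $n_B$ with $S^L$ messages (encoder a map from messages to $\mathcal X^{n_B}$, decoders $g_k:\mathcal Y^{n_B}\to$ messages) with $\mathbb P[g_k(Y_k^{n_B})\ne J]\le\epsilon$ for $k=1,2$. Indexing: elements $\mathbb x\in\mathcal X^{SLm}$ are written $\mathbb x=(\mathbb x_1(1),\dots,\mathbb x_1(S),\dots,\mathbb x_L(1),\dots,\mathbb x_L(S))$ with $\mathbb x_\ell(s)=(\mathbb x_{\ell,1}(s),\dots,\mathbb x_{\ell,m}(s))\in\mathcal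 X^m$; for $b^\ell\in\{1,\dots,S\}^\ell$, $\mathbb x^\ell(b^\ell)=(\mathbb x_1(b_1),\dots,\mathbb x_\ell(b_\ell))$; the same indexing is used for elements $\mathbb y_k\in\mathcal Y^{SLm}$. The distribution of $(\mathbb Y_1,\mathbb Y_2,B^L)\in\mathcal Y^{SLm}\times\mathcal Y^{SLm}\times\{1,\dots,S\}^L$ is $$\mathbb P_{\mathbb Y_1,\mathbb Y_2,B^L}(\mathbb y_1,\mathbb y_2,b^L)=\prod_{\ell=1}^L\Big(\prod_{s=1}^S\prod_{k=1}^2W_k^m(\mathbb y_{k,\ell}(s)|\mathbb x_\ell(s))\Big)\mathbb 1\{h_\ell(\mathbb x^{\ell-1}(b^{\ell-1}),\mathbb y_1^{\ell-1}(b^{\ell-1}),\mathbb y_2^{\ell-1}(b^{\ell-1}))=b_\ell\},$$ where $W_k^m$ is the product channel. Finally $\imath_k(\mathbb x_\ell(b_\ell);\mathbb y_{k,\ell}(b_\ell))=\sum_{i=1}^m\imath_{P_{b_\ell},W_k}(\mathbb x_{\ell,i}(b_\ell);\mathbb y_{k,\ell,i}(b_\ell))$ and $\imath_k(\mathbb x^L(b^L);\mathbb y_k^L(b^L))=\sum_{\ell=1}^L\imath_k(\mathbb x_\ell(b_\ell);\mathbb y_{k,\ell}(b_\ell))$. Logarithms are natural. *)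

theory Defs
  imports "HOL-Probability.Probability"
begin

(* Channels are written W x y = W(y|x); alphabets are finite types 'x, 'y.
   Logarithms are natural (ln). *)

definition stochastic :: "('x::finite \<Rightarrow> 'y::finite \<Rightarrow> real) \<Rightarrow> bool" where
  "stochastic W \<longleftrightarrow> (\<forall>x y. 0 \<le> W x y) \<and> (\<forall>x. (\<Sum>y\<in>UNIV. W x y) = 1)"

definition prodW :: "('x \<Rightarrow> 'y \<Rightarrow> real) \<Rightarrow> 'x list \<Rightarrow> 'y list \<Rightarrow> real" where
  "prodW W xs ys = (\<Prod>i<length xs. W (xs ! i) (ys ! i))"

(* A deterministic feedback encoder: enc i j ys1 ys2 = f_i(j, y1^{i-1}, y2^{i-1}), i = 1..n.
   Probability of output sequences (y1^n, y2^n) when message j is sent. *)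
definition flf_prob ::
  "('x \<Rightarrow> 'y \<Rightarrow> real) \<Rightarrow> ('x \<Rightarrow> 'y \<Rightarrow> real) \<Rightarrow> nat \<Rightarrow>
   (nat \<Rightarrow> nat \<Rightarrow> 'y list \<Rightarrow> 'y list \<Rightarrow> 'x) \<Rightarrow> nat \<Rightarrow> 'y list \<Rightarrow> 'y list \<Rightarrow> real" where
  "flf_prob W1 W2 n enc j y1 y2 =
     (\<Prod>i\<in>{1..n}. W1 (enc i j (take (i - 1) y1) (take (i - 1) y2)) (y1 ! (i - 1))
                 * W2 (enc i j (take (i - 1) y1) (take (i - 1) y2)) (y2 ! (i - 1)))"

definition flf_err ::
  "('x::finite \<Rightarrow> 'y::finite \<Rightarrow> real) \<Rightarrow> ('x \<Rightarrow> 'y \<Rightarrow> real) \<Rightarrow> nat \<Rightarrow> nat \<Rightarrow>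
   (nat \<Rightarrow> nat \<Rightarrow> 'y list \<Rightarrow> 'y list \<Rightarrow> 'x) \<Rightarrow> nat \<Rightarrow> ('y list \<Rightarrow> nat) \<Rightarrow> real" where
  "flf_err W1 W2 n M enc k g =
     (1 / real M) * (\<Sum>j\<in>{1..M}. \<Sum>y1\<in>{ys. length ys = n}. \<Sum>y2\<in>{ys. length ys = n}.
        flf_prob W1 W2 n enc j y1 y2 * (if g (if k = 1 then y1 else y2) \<noteq> j then 1 else 0))"

(* (n,M,eps)-FLF code: a possibly randomized encoder, i.e. a probability distribution Q over
   deterministic feedback encoders, and deterministic decoders g1, g2 *)
definition flf_code ::
  "('x::finite \<Rightarrow> 'y::finite \<Rightarrow> real) \<Rightarrow> ('x \<Rightarrow> 'y \<Rightarrow> real) \<Rightarrow> nat \<Rightarrow> nat \<Rightarrow> real \<Rightarrow>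
   (nat \<Rightarrow> nat \<Rightarrow> 'y list \<Rightarrow> 'y list \<Rightarrow> 'x) pmf \<Rightarrow> ('y list \<Rightarrow> nat) \<Rightarrow> ('y list \<Rightarrow> nat) \<Rightarrow> bool" where
  "flf_code W1 W2 n M eps Q g1 g2 \<longleftrightarrow> M \<ge> 1 \<and>
     measure_pmf.expectation Q (\<lambda>enc. flf_err W1 W2 n M enc 1 g1) \<le> eps \<and>
     measure_pmf.expectation Q (\<lambda>enc. flf_err W1 W2 n M enc 2 g2) \<le> eps"

definition Mstar_f :: "('x::finite \<Rightarrow> 'y::finite \<Rightarrow> real) \<Rightarrow> ('x \<Rightarrow> 'y \<Rightarrow> real) \<Rightarrow> nat \<Rightarrow> real \<Rightarrow> ereal" where
  "Mstar_f W1 W2 n eps = Sup {ereal (real M) | M. \<exists>Q g1 g2. flf_code W1 W2 n M eps Q g1 g2}"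

definition ln_ereal :: "ereal \<Rightarrow> ereal" where
  "ln_ereal z = (if z = \<infinity> then \<infinity> else if z > 0 then ereal (ln (real_of_ereal z)) else -\<infinity>)"

definition nf_err ::
  "('x::finite \<Rightarrow> 'y::finite \<Rightarrow> real) \<Rightarrow> nat \<Rightarrow> nat \<Rightarrow> (nat \<Rightarrow> 'x list) \<Rightarrow> ('y list \<Rightarrow> nat) \<Rightarrow> real" where
  "nf_err W n M enc g =
     (1 / real M) * (\<Sum>j\<in>{1..M}. \<Sum>ys\<in>{ys. length ys = n}.
        prodW W (enc j) ys * (if g ys \<noteq> j then 1 else 0))"

definition eps_star :: "('x::finite \<Rightarrow> 'y::finite \<Rightarrow> real) \<Rightarrow> ('x \<Rightarrow> 'y \<Rightarrow> real) \<Rightarrow> nat \<Rightarrow> nat \<Rightarrow> real" where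
  "eps_star W1 W2 n M = Inf {e. \<exists>enc g1 g2. (\<forall>j\<in>{1..M}. length (enc j) = n) \<and>
       nf_err W1 n M enc g1 \<le> e \<and> nf_err W2 n M enc g2 \<le> e}"

definition has_type :: "nat \<Rightarrow> 'x list \<Rightarrow> ('x \<Rightarrow> real) \<Rightarrow> bool" where
  "has_type m xs P \<longleftrightarrow> length xs = m \<and> (\<forall>a. P a = real (count_list xs a) / real m)"

definition is_type :: "nat \<Rightarrow> ('x \<Rightarrow> real) \<Rightarrow> bool" where
  "is_type m P \<longleftrightarrow> (\<exists>xs. has_type m xs P)"

definition in_F :: "nat \<Rightarrow> nat \<Rightarrow> nat \<Rightarrow> (nat \<Rightarrow> 'x \<Rightarrow> real) \<Rightarrow> (nat \<Rightarrow> nat \<Rightarrow> 'x list) \<Rightarrow> bool" where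
  "in_F S L m P xx \<longleftrightarrow> (\<forall>s\<in>{1..S}. \<forall>l\<in>{1..L}. has_type m (xx l s) (P s))"

definition xprefix :: "(nat \<Rightarrow> nat \<Rightarrow> 'x list) \<Rightarrow> nat \<Rightarrow> (nat \<Rightarrow> nat) \<Rightarrow> 'x list" where
  "xprefix xx l b = concat (map (\<lambda>j. xx j (b j)) [1..<l])"

definition yprefix :: "(nat \<times> nat \<Rightarrow> 'y list) \<Rightarrow> nat \<Rightarrow> (nat \<Rightarrow> nat) \<Rightarrow> 'y list" where
  "yprefix yy l b = concat (map (\<lambda>j. yy (j, b j)) [1..<l])"

(* the set \<Y>^{SLm}: yy (l,s) = \<bbby>_l(s) \<in> Y^m *)
definition Yspace :: "nat \<Rightarrow> nat \<Rightarrow> nat \<Rightarrow> (nat \<times> nat \<Rightarrow> 'y list) set" where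
  "Yspace S L m = PiE ({1..L} \<times> {1..S}) (\<lambda>_. {ys. length ys = m})"

definition Bspace :: "nat \<Rightarrow> nat \<Rightarrow> (nat \<Rightarrow> nat) set" where
  "Bspace S L = PiE {1..L} (\<lambda>_. {1..S})"

definition joint_pmf ::
  "('x \<Rightarrow> 'y \<Rightarrow> real) \<Rightarrow> ('x \<Rightarrow> 'y \<Rightarrow> real) \<Rightarrow> nat \<Rightarrow> nat \<Rightarrow>
   (nat \<Rightarrow> 'x list \<Rightarrow> 'y list \<Rightarrow> 'y list \<Rightarrow> nat) \<Rightarrow> (nat \<Rightarrow> nat \<Rightarrow> 'x list) \<Rightarrow>
   (nat \<times> nat \<Rightarrow> 'y list) \<Rightarrow> (nat \<times> nat \<Rightarrow> 'y list) \<Rightarrow> (nat \<Rightarrow> nat) \<Rightarrow> real" where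
  "joint_pmf W1 W2 S L h xx yy1 yy2 b =
     (\<Prod>l\<in>{1..L}. (\<Prod>s\<in>{1..S}. prodW W1 (xx l s) (yy1 (l, s)) * prodW W2 (xx l s) (yy2 (l, s)))
        * (if h l (xprefix xx l b) (yprefix yy1 l b) (yprefix yy2 l b) = b l then 1 else 0))"

definition idens :: "('x::finite \<Rightarrow> real) \<Rightarrow> ('x \<Rightarrow> 'y \<Rightarrow> real) \<Rightarrow> 'x \<Rightarrow> 'y \<Rightarrow> real" where
  "idens P W x y = ln (W x y / (\<Sum>x'\<in>UNIV. P x' * W x' y))"

definition idens_total ::
  "nat \<Rightarrow> nat \<Rightarrow> (nat \<Rightarrow> 'x::finite \<Rightarrow> real) \<Rightarrow> ('x \<Rightarrow> 'y \<Rightarrow> real) \<Rightarrow>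
   (nat \<Rightarrow> nat \<Rightarrow> 'x list) \<Rightarrow> (nat \<times> nat \<Rightarrow> 'y list) \<Rightarrow> (nat \<Rightarrow> nat) \<Rightarrow> real" where
  "idens_total L m P W xx yy b =
     (\<Sum>l\<in>{1..L}. \<Sum>i<m. idens (P (b l)) W (xx l (b l) ! i) (yy (l, b l) ! i))"

definition tail_prob ::
  "('x::finite \<Rightarrow> 'y::finite \<Rightarrow> real) \<Rightarrow> ('x \<Rightarrow> 'y \<Rightarrow> real) \<Rightarrow> nat \<Rightarrow> nat \<Rightarrow> nat \<Rightarrow>
   (nat \<Rightarrow> 'x \<Rightarrow> real) \<Rightarrow> (nat \<Rightarrow> 'x list \<Rightarrow> 'y list \<Rightarrow> 'y list \<Rightarrow> nat) \<Rightarrow>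
   (nat \<Rightarrow> nat \<Rightarrow> 'x list) \<Rightarrow> nat \<Rightarrow> real \<Rightarrow> real" where
  "tail_prob W1 W2 S L m P h xx k \<gamma> =
     (\<Sum>yy1\<in>Yspace S L m. \<Sum>yy2\<in>Yspace S L m. \<Sum>b\<in>Bspace S L.
        joint_pmf W1 W2 S L h xx yy1 yy2 b *
        (if (if k = 1 then idens_total L m P W1 xx yy1 b else idens_total L m P W2 xx yy2 b) \<le> \<gamma>
         then 1 else 0))"

end

theory Submission
  imports Defs "HOL-Combinatorics.Multiset_Permutations"
begin

text \<open>
  Permuting each block of the given array by a fixed permutation yields, for every tuple of
  permutations, a feedback scheme whose outputs, with the permutations undone, have the same law.
  These schemes are the candidate codewords of a maximal coding argument in the style of Feinstein.
  A receiver accepts a codeword if, along some path, the likelihood of its output exceeds a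
  threshold times the output law of a uniformly random candidate. This mixture is invariant under
  block permutations. Averaging over type classes bounds its part along a fixed path by
  \<open>(1 + m) ^ (L * |X|)\<close> times the memoryless law that defines the information density, and there are
  \<open>S ^ L\<close> paths; so up to these factors it may be replaced by the memoryless law, except with
  probability \<open>exp (- \<zeta>)\<close>. Testing all paths costs a second factor \<open>S ^ L\<close>, which
  \<open>(1 + m) ^ ((S - 1) * L * |X|)\<close> absorbs. Hence the receivers never need to be told the path: the
  last \<open>nB\<close> channel uses are ignored, and \<open>eps_star\<close> enters only through \<open>eps_star \<ge> 0\<close>.
\<close>

subsection \<open>Sums over lists and product sets\<close>

lemma finite_lists_length_eq_UNIV: "finite {xs :: 'a::finite list. length xs = n}"
  using finite_lists_length_eq[of "UNIV :: 'a set" n] by simp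

lemma sum_lists_prod:
  fixes f :: "nat \<Rightarrow> 'a::finite \<Rightarrow> 'b::comm_semiring_1"
  shows "(\<Sum>xs\<in>{xs. length xs = n}. \<Prod>i<n. f i (xs ! i)) = (\<Prod>i<n. \<Sum>a\<in>UNIV. f i a)"
proof (induction n arbitrary: f)
  case 0
  then show ?case by simp
next
  case (Suc n)
  have "{xs :: 'a list. length xs = Suc n} = (\<lambda>(a, xs). a # xs) ` (UNIV \<times> {xs. length xs = n})"
    by (auto simp: length_Suc_conv image_iff)
  moreover have "inj_on (\<lambda>(a, xs). a # xs) (UNIV \<times> {xs :: 'a list. length xs = n})"
    by (auto simp: inj_on_def)
  ultimately have "(\<Sum>xs\<in>{xs. length xs = Suc n}. \<Prod>i<Suc n. f i (xs ! i))
      = (\<Sum>(a, xs)\<in>UNIV \<times> {xs. length xs = n}. f 0 a * (\<Prod>i<n. f (Suc i) (xs ! i)))"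
    by (simp add: sum.reindex prod.lessThan_Suc_shift case_prod_unfold del: prod.lessThan_Suc)
  also have "\<dots> = (\<Sum>a\<in>UNIV. f 0 a) * (\<Prod>i<n. \<Sum>a\<in>UNIV. f (Suc i) a)"
    by (simp add: Suc.IH[of "\<lambda>i. f (Suc i)", symmetric] sum_product sum.cartesian_product)
  finally show ?case by (simp add: prod.lessThan_Suc_shift del: prod.lessThan_Suc)
qed

lemma sum_PiE_atLeastAtMost_Suc:
  fixes f :: "(nat \<Rightarrow> 'b) \<Rightarrow> 'c::comm_monoid_add"
  shows "(\<Sum>v\<in>PiE {1..Suc n} A. f v) = (\<Sum>v\<in>PiE {1..n} A. \<Sum>y\<in>A (Suc n). f (v(Suc n := y)))"
proof -
  have "{1..Suc n} = insert (Suc n) {1..n}" by auto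
  then have "(\<Sum>v\<in>PiE {1..Suc n} A. f v) = (\<Sum>(y, v)\<in>A (Suc n) \<times> PiE {1..n} A. f (v(Suc n := y)))"
    by (simp only: PiE_insert_eq, subst sum.reindex[OF inj_combinator])
      (auto simp: case_prod_unfold)
  also have "\<dots> = (\<Sum>y\<in>A (Suc n). \<Sum>v\<in>PiE {1..n} A. f (v(Suc n := y)))"
    by (rule sum.cartesian_product[symmetric])
  finally show ?thesis by (simp add: sum.swap[of _ "A (Suc n)"])
qed

lemma PiE_fiber_reindex:
  assumes \<sigma>_inj: "inj_on \<sigma> K" "\<sigma> ` K \<subseteq> I" and v_mem: "v \<in> PiE K (A \<circ> \<sigma>)"
  shows "{x \<in> PiE I A. (\<lambda>k\<in>K. x (\<sigma> k)) = v}
    = PiE I (\<lambda>i. if i \<in> \<sigma> ` K then {v (the_inv_into K \<sigma> i)} else A i)" (is "_ = PiE I ?D")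
proof (intro subset_antisym subsetI)
  fix x assume "x \<in> {x \<in> PiE I A. (\<lambda>k\<in>K. x (\<sigma> k)) = v}"
  then have "x \<in> PiE I A" and "\<And>k. k \<in> K \<Longrightarrow> x (\<sigma> k) = v k" by auto
  then show "x \<in> PiE I ?D" using \<sigma>_inj(1) by (auto simp: PiE_iff the_inv_into_f_f)
next
  fix x assume x_mem: "x \<in> PiE I ?D"
  then have v_eq: "x (\<sigma> k) = v k" if "k \<in> K" for k
    using that \<sigma>_inj PiE_mem[OF x_mem, of "\<sigma> k"] by (auto simp: the_inv_into_f_f)
  moreover have "x \<in> PiE I A"
  proof (rule PiE_I)
    fix i assume "i \<in> I"
    then show "x i \<in> A i"
      using PiE_mem[OF x_mem, of i] v_eq PiE_mem[OF v_mem] by (cases "i \<in> \<sigma> ` K") fastforce+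
  qed (use x_mem in auto)
  ultimately show "x \<in> {x \<in> PiE I A. (\<lambda>k\<in>K. x (\<sigma> k)) = v}"
    using v_mem by (auto simp: PiE_def extensional_def fun_eq_iff)
qed

lemma sum_PiE_marginal:
  fixes p :: "'i \<Rightarrow> 'a \<Rightarrow> 'b::comm_semiring_1"
  assumes finite_I: "finite I" "\<And>i. i \<in> I \<Longrightarrow> finite (A i)"
    and p_sum: "\<And>i. i \<in> I \<Longrightarrow> (\<Sum>y\<in>A i. p i y) = 1"
    and \<sigma>_inj: "inj_on \<sigma> K" "\<sigma> ` K \<subseteq> I"
  shows "(\<Sum>x\<in>PiE I A. (\<Prod>i\<in>I. p i (x i)) * f (\<lambda>k\<in>K. x (\<sigma> k)))
    = (\<Sum>v\<in>PiE K (A \<circ> \<sigma>). (\<Prod>k\<in>K. p (\<sigma> k) (v k)) * f v)"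
proof -
  define fiber where "fiber v = {x \<in> PiE I A. (\<lambda>k\<in>K. x (\<sigma> k)) = v}" for v
  have "finite K" using \<sigma>_inj finite_I(1) by (metis finite_imageD finite_subset)
  have fiber: "(\<Sum>x\<in>fiber v. \<Prod>i\<in>I. p i (x i)) = (\<Prod>k\<in>K. p (\<sigma> k) (v k))"
    if v_mem: "v \<in> PiE K (A \<circ> \<sigma>)" for v
  proof -
    have "(\<Sum>x\<in>fiber v. \<Prod>i\<in>I. p i (x i))
        = (\<Prod>i\<in>I. if i \<in> \<sigma> ` K then p i (v (the_inv_into K \<sigma> i)) else 1)"
      unfolding fiber_def PiE_fiber_reindex[OF \<sigma>_inj v_mem]
      by (subst prod_sum_PiE[symmetric]) (auto simp: finite_I p_sum intro!: prod.cong)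
    also have "\<dots> = (\<Prod>i\<in>\<sigma> ` K. p i (v (the_inv_into K \<sigma> i)))"
      using finite_I(1) \<sigma>_inj(2) by (simp add: prod.If_cases Int_absorb1)
    finally show ?thesis
      using \<sigma>_inj(1) by (simp add: prod.reindex the_inv_into_f_f)
  qed
  have "finite (PiE I A)" "finite (PiE K (A \<circ> \<sigma>))"
    using finite_I \<sigma>_inj(2) \<open>finite K\<close> by (auto intro!: finite_PiE)
  moreover have "(\<lambda>x. \<lambda>k\<in>K. x (\<sigma> k)) ` PiE I A \<subseteq> PiE K (A \<circ> \<sigma>)"
    using \<sigma>_inj(2) by (auto simp: PiE_iff image_subset_iff)
  ultimately have "(\<Sum>x\<in>PiE I A. (\<Prod>i\<in>I. p i (x i)) * f (\<lambda>k\<in>K. x (\<sigma> k)))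
      = (\<Sum>v\<in>PiE K (A \<circ> \<sigma>). \<Sum>x\<in>fiber v. (\<Prod>i\<in>I. p i (x i)) * f (\<lambda>k\<in>K. x (\<sigma> k)))"
    unfolding fiber_def by (rule sum.group[symmetric])
  also have "\<dots> = (\<Sum>v\<in>PiE K (A \<circ> \<sigma>). (\<Sum>x\<in>fiber v. \<Prod>i\<in>I. p i (x i)) * f v)"
    by (simp add: fiber_def sum_distrib_right)
  finally show ?thesis by (simp add: fiber)
qed

subsection \<open>Type classes\<close>

lemma power_mult_fact_le: "(k::nat) ^ l * fact k \<le> k ^ k * fact l"
proof (cases "k \<le> l")
  case True
  then show ?thesis
  proof (induction l rule: dec_induct)
    case (step l)
    have "k ^ Suc l * fact k = k * (k ^ l * fact k)" by simp
    also have "\<dots> \<le> Suc l * (k ^ k * fact l)" using step by (intro mult_mono[OF _ step.IH]) auto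
    finally show ?case by (simp add: algebra_simps)
  qed simp
next
  case False
  then have "l \<le> k" by simp
  then show ?thesis
  proof (induction l rule: inc_induct)
    case (step l)
    have "Suc l * (k ^ l * fact k) \<le> k * (k ^ l * fact k)"
      using step.hyps by (intro mult_right_mono) auto
    also have "\<dots> = k ^ Suc l * fact k" by simp
    also have "\<dots> \<le> k ^ k * fact (Suc l)" by (rule step.IH)
    also have "\<dots> = Suc l * (k ^ k * fact l)" by (simp only: fact_Suc of_nat_id mult.left_commute)
    finally show ?case by (simp only: Suc_mult_le_cancel1)
  qed simp
qed

lemma sum_count_UNIV: "(\<Sum>a\<in>UNIV. count A a) = size A" for A :: "'a::finite multiset"
  unfolding size_multiset_overloaded_eq by (rule sum.mono_neutral_right) (auto simp: not_in_iff)

lemma prod_list_map_eq_prod_power_count: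
  fixes f :: "'a::finite \<Rightarrow> 'b::comm_monoid_mult"
  shows "prod_list (map f xs) = (\<Prod>a\<in>UNIV. f a ^ count (mset xs) a)"
proof -
  have "prod_list (map f xs) = (\<Prod>a\<in>set_mset (mset xs). f a ^ count (mset xs) a)"
    by (simp only: image_prod_mset_multiplicity[symmetric] mset_map[symmetric] prod_mset_prod_list)
  also have "\<dots> = (\<Prod>a\<in>UNIV. f a ^ count (mset xs) a)"
    by (rule prod.mono_neutral_left) (auto simp: count_mset_0_iff[THEN iffD2])
  finally show ?thesis .
qed

lemma real_card_permutations_of_multiset:
  fixes A :: "'a::finite multiset"
  shows "real (card (permutations_of_multiset A)) = fact (size A) / (\<Prod>a\<in>UNIV. fact (count A a))"
proof -
  have "(\<Prod>a\<in>set_mset A. fact (count A a) :: nat) = (\<Prod>a\<in>UNIV. fact (count A a))"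
    by (rule prod.mono_neutral_left) (auto simp: not_in_iff)
  then show ?thesis
    using arg_cong[OF card_permutations_of_multiset_aux[of A], of real] by (simp add: field_simps)
qed

definition empirical_dist :: "'a multiset \<Rightarrow> 'a \<Rightarrow> real" where
  "empirical_dist A a = real (count A a) / real (size A)"

definition type_class_prob :: "('a \<Rightarrow> real) \<Rightarrow> 'a multiset \<Rightarrow> real" where
  "type_class_prob p A = (\<Sum>xs\<in>permutations_of_multiset A. prod_list (map p xs))"

lemma type_class_prob_eq:
  fixes A :: "'a::finite multiset"
  shows "type_class_prob p A
    = real (card (permutations_of_multiset A)) * (\<Prod>a\<in>UNIV. p a ^ count A a)"
  unfolding type_class_prob_def
  by (simp add: prod_list_map_eq_prod_power_count permutations_of_multisetD)

lemma sum_type_class_prob: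
  fixes p :: "'a::finite \<Rightarrow> real"
  shows "(\<Sum>A\<in>multisets_of_size UNIV n. type_class_prob p A) = (\<Sum>a\<in>UNIV. p a) ^ n"
proof -
  have "(\<Sum>A\<in>multisets_of_size UNIV n. type_class_prob p A)
      = (\<Sum>A\<in>multisets_of_size UNIV n. \<Sum>xs\<in>{xs \<in> {xs. length xs = n}. mset xs = A}.
          prod_list (map p xs))"
    unfolding type_class_prob_def
    by (intro sum.cong) (auto simp: permutations_of_multiset_def multisets_of_size_def)
  also have "\<dots> = (\<Sum>xs\<in>{xs. length xs = n}. prod_list (map p xs))"
    by (rule sum.group[OF finite_lists_length_eq_UNIV finite_multisets_of_size])
      (auto simp: multisets_of_size_def)
  also have "\<dots> = (\<Sum>xs\<in>{xs. length xs = n}. \<Prod>i<n. p (xs ! i))"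
    by (intro sum.cong refl) (auto simp: prod.list_conv_set_nth atLeast0LessThan)
  also have "\<dots> = (\<Sum>a\<in>UNIV. p a) ^ n"
    using sum_lists_prod[of "\<lambda>_. p" n] by simp
  finally show ?thesis .
qed

lemma card_multisets_of_size_UNIV_le:
  "card (multisets_of_size (UNIV :: 'a::finite set) n) \<le> (1 + n) ^ CARD('a)"
proof -
  have "card (multisets_of_size (UNIV :: 'a set) n) \<le> card (PiE (UNIV :: 'a set) (\<lambda>_. {..n}))"
    by (rule card_inj_on_le[where f = count])
      (auto simp: inj_on_def multiset_eq_iff multisets_of_size_def count_le_size intro!: finite_PiE)
  then show ?thesis by (simp add: card_PiE)
qed

lemma type_class_prob_empirical_dist_le:
  fixes A B :: "'a::finite multiset"
  assumes "size B = size A"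
  shows "type_class_prob (empirical_dist A) B \<le> type_class_prob (empirical_dist A) A"
proof -
  have prob_eq: "type_class_prob (empirical_dist A) C
      = fact (size A) / real (size A) ^ size A
        * ((\<Prod>a\<in>UNIV. real (count A a) ^ count C a) / (\<Prod>a\<in>UNIV. fact (count C a)))"
    if "size C = size A" for C
    using that unfolding type_class_prob_eq real_card_permutations_of_multiset empirical_dist_def
    by (simp add: power_divide prod_dividef power_sum[symmetric] sum_count_UNIV)
  have fact_pos: "0 < (\<Prod>a\<in>UNIV. fact (count C a) :: real)" for C :: "'a multiset"
    by (intro prod_pos) simp
  have "(\<Prod>a\<in>UNIV. real (count A a) ^ count B a) * (\<Prod>a\<in>UNIV. fact (count A a))
      \<le> (\<Prod>a\<in>UNIV. real (count A a) ^ count A a) * (\<Prod>a\<in>UNIV. fact (count B a))"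
    unfolding prod.distrib[symmetric]
  proof (intro prod_mono conjI)
    fix a
    show "real (count A a) ^ count B a * fact (count A a)
        \<le> real (count A a) ^ count A a * fact (count B a)"
      using power_mult_fact_le[of "count A a" "count B a"]
      by (metis (mono_tags) of_nat_fact of_nat_le_iff of_nat_mult of_nat_power)
  qed simp
  then have "(\<Prod>a\<in>UNIV. real (count A a) ^ count B a) / (\<Prod>a\<in>UNIV. fact (count B a))
      \<le> (\<Prod>a\<in>UNIV. real (count A a) ^ count A a) / (\<Prod>a\<in>UNIV. fact (count A a))"
    using fact_pos[of A] fact_pos[of B] by (simp add: divide_simps)
  then show ?thesis
    unfolding prob_eq[OF assms] prob_eq[OF refl] by (rule mult_left_mono) simp
qed

lemma type_class_prob_empirical_dist_ge:
  fixes A :: "'a::finite multiset"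
  shows "1 \<le> (1 + real (size A)) ^ CARD('a) * type_class_prob (empirical_dist A) A"
proof -
  have "(\<Sum>a\<in>UNIV. empirical_dist A a) ^ size A = 1"
    unfolding empirical_dist_def sum_divide_distrib[symmetric] of_nat_sum[symmetric] sum_count_UNIV
    by (cases "size A = 0") auto
  then have "1 = (\<Sum>B\<in>multisets_of_size UNIV (size A). type_class_prob (empirical_dist A) B)"
    by (simp add: sum_type_class_prob)
  also have "\<dots> \<le> (\<Sum>B\<in>multisets_of_size (UNIV :: 'a set) (size A).
      type_class_prob (empirical_dist A) A)"
    by (intro sum_mono type_class_prob_empirical_dist_le) (simp add: multisets_of_size_def)
  also have "\<dots> \<le> (1 + real (size A)) ^ CARD('a) * type_class_prob (empirical_dist A) A"
    using of_nat_mono[OF card_multisets_of_size_UNIV_le, where 'a = real]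
    by (auto simp: type_class_prob_eq empirical_dist_def
        intro!: mult_right_mono mult_nonneg_nonneg prod_nonneg)
  finally show ?thesis .
qed

lemma has_type_iff: "has_type m xs P \<longleftrightarrow> length xs = m \<and> P = empirical_dist (mset xs)"
  by (auto simp: has_type_def empirical_dist_def count_mset fun_eq_iff)

lemma permute_list_inv:
  assumes "p permutes {..<length xs}"
  shows "permute_list (inv p) (permute_list p xs) = xs"
    and "permute_list p (permute_list (inv p) xs) = xs"
  using permute_list_compose[OF permutes_inv[OF assms], of p]
    permute_list_compose[OF assms, of "inv p"]
  by (simp_all add: permutes_inv_o[OF assms])

lemma sum_permutations_of_multiset_permute_list:
  assumes p_permutes: "p permutes {..<size A}"
  shows "(\<Sum>xs\<in>permutations_of_multiset A. f (permute_list p xs))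
    = (\<Sum>xs\<in>permutations_of_multiset A. f xs)"
proof (rule sum.reindex_bij_witness[of _ "permute_list (inv p)" "permute_list p"])
  fix xs assume "xs \<in> permutations_of_multiset A"
  moreover from this have "p permutes {..<length xs}"
    using p_permutes length_finite_permutations_of_multiset by metis
  ultimately show "permute_list (inv p) (permute_list p xs) = xs"
    "permute_list p (permute_list (inv p) xs) = xs"
    "permute_list p xs \<in> permutations_of_multiset A"
    "permute_list (inv p) xs \<in> permutations_of_multiset A"
    by (auto simp: permute_list_inv permutations_of_multiset_def permutes_inv)
qed simp

lemma sum_permutes_permute_list_cong:
  assumes "mset xs = mset ys"
  shows "(\<Sum>p\<in>{p. p permutes {..<length xs}}. f (permute_list p xs))
    = (\<Sum>p\<in>{p. p permutes {..<length ys}}. f (permute_list p ys))"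
proof -
  obtain r where r_permutes: "r permutes {..<length ys}" "permute_list r ys = xs"
    using mset_eq_permutation[OF assms] .
  have "(\<Sum>p\<in>{p. p permutes {..<length ys}}. f (permute_list p ys))
      = (\<Sum>p\<in>{p. p permutes {..<length ys}}. f (permute_list (r \<circ> p) ys))"
    by (rule setum_permutations_compose_left[OF r_permutes(1)])
  also have "\<dots> = (\<Sum>p\<in>{p. p permutes {..<length ys}}. f (permute_list p xs))"
    by (intro sum.cong refl) (simp add: permute_list_compose r_permutes(2))
  finally show ?thesis using mset_eq_length[OF assms] by simp
qed

text \<open>Double counting of the pairs of a permutation and an element of the type class.\<close>

lemma sum_permutes_permute_list:
  fixes f :: "'a list \<Rightarrow> real"
  shows "real (card (permutations_of_multiset (mset xs)))
      * (\<Sum>p\<in>{p. p permutes {..<length xs}}. f (permute_list p xs))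
    = fact (length xs) * (\<Sum>ys\<in>permutations_of_multiset (mset xs). f ys)"
proof -
  let ?T = "permutations_of_multiset (mset xs)" and ?S = "{p. p permutes {..<length xs}}"
  have "real (card ?T) * (\<Sum>p\<in>?S. f (permute_list p xs))
      = (\<Sum>ys\<in>?T. \<Sum>p\<in>?S. f (permute_list p xs))" by simp
  also have "\<dots> = (\<Sum>ys\<in>?T. \<Sum>p\<in>?S. f (permute_list p ys))"
  proof (rule sum.cong[OF refl])
    fix ys assume "ys \<in> ?T"
    then have "mset xs = mset ys" by (simp add: permutations_of_multiset_def)
    from sum_permutes_permute_list_cong[OF this] mset_eq_length[OF this]
    show "(\<Sum>p\<in>?S. f (permute_list p xs)) = (\<Sum>p\<in>?S. f (permute_list p ys))" by simp
  qed
  also have "\<dots> = (\<Sum>p\<in>?S. \<Sum>ys\<in>?T. f (permute_list p ys))" by (rule sum.swap)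
  also have "\<dots> = (\<Sum>p\<in>?S. \<Sum>ys\<in>?T. f ys)"
    by (intro sum.cong refl sum_permutations_of_multiset_permute_list) simp
  finally show ?thesis by (simp add: card_permutations)
qed

subsection \<open>Memoryless channels\<close>

definition output_law :: "('x::finite \<Rightarrow> real) \<Rightarrow> ('x \<Rightarrow> 'y \<Rightarrow> real) \<Rightarrow> 'y \<Rightarrow> real" where
  "output_law P W y = (\<Sum>x\<in>UNIV. P x * W x y)"

lemma stochastic_nonneg: "stochastic W \<Longrightarrow> 0 \<le> W x y"
  by (simp add: stochastic_def)

lemma prodW_nonneg: "stochastic W \<Longrightarrow> 0 \<le> prodW W xs ys"
  by (auto simp: prodW_def stochastic_def intro!: prod_nonneg)

lemma sum_prodW:
  assumes "stochastic W" "length xs = n"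
  shows "(\<Sum>ys\<in>{ys. length ys = n}. prodW W xs ys) = 1"
  using assms sum_lists_prod[of "\<lambda>i. W (xs ! i)" n] by (simp add: prodW_def stochastic_def)

lemma prodW_append:
  assumes "length xs = length ys"
  shows "prodW W (xs @ xs') (ys @ ys') = prodW W xs ys * prodW W xs' ys'"
  using assms
proof (induction xs ys rule: list_induct2)
  case (Cons x xs y ys)
  then show ?case by (simp add: prodW_def prod.lessThan_Suc_shift mult.assoc del: prod.lessThan_Suc)
qed (simp add: prodW_def)

lemma prodW_permute_list:
  assumes p_permutes: "p permutes {..<length ys}" and length_eq: "length xs = length ys"
  shows "prodW W xs (permute_list p ys) = prodW W (permute_list (inv p) xs) ys"
proof -
  have "prodW W (permute_list (inv p) xs) ys = (\<Prod>i<length xs. W (xs ! inv p i) (ys ! i))"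
    using p_permutes length_eq by (simp add: prodW_def permute_list_nth permutes_inv)
  also have "\<dots> = (\<Prod>i<length xs. W (xs ! inv p (p i)) (ys ! p i))"
    using prod.permute[OF p_permutes, of "\<lambda>i. W (xs ! inv p i) (ys ! i)"] length_eq
    by (simp add: o_def)
  also have "\<dots> = prodW W xs (permute_list p ys)"
    using p_permutes length_eq by (simp add: prodW_def permute_list_nth permutes_inverses)
  finally show ?thesis by simp
qed

lemma sum_type_class_prodW_le:
  assumes W_nonneg: "\<And>x y. 0 \<le> W x y" and P_nonneg: "\<And>x. 0 \<le> P x"
    and length_eq: "length ys = size A"
  shows "(\<Prod>a\<in>UNIV. P a ^ count A a) * (\<Sum>xs\<in>permutations_of_multiset A. prodW W xs ys)
    \<le> prod_list (map (output_law P W) ys)"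
proof -
  have "(\<Prod>a\<in>UNIV. P a ^ count A a) * (\<Sum>xs\<in>permutations_of_multiset A. prodW W xs ys)
      = (\<Sum>xs\<in>permutations_of_multiset A. prod_list (map P xs) * prodW W xs ys)"
    by (simp add: sum_distrib_left prod_list_map_eq_prod_power_count permutations_of_multisetD)
  also have "\<dots> = (\<Sum>xs\<in>permutations_of_multiset A. \<Prod>i<size A. P (xs ! i) * W (xs ! i) (ys ! i))"
    by (intro sum.cong refl)
      (auto simp: prod.list_conv_set_nth atLeast0LessThan prodW_def prod.distrib
        permutations_of_multiset_def)
  also have "\<dots> \<le> (\<Sum>xs\<in>{xs. length xs = size A}. \<Prod>i<size A. P (xs ! i) * W (xs ! i) (ys ! i))"
    by (intro sum_mono2 finite_lists_length_eq_UNIV prod_nonneg)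
      (auto simp: W_nonneg P_nonneg length_finite_permutations_of_multiset)
  also have "\<dots> = prod_list (map (output_law P W) ys)"
    using sum_lists_prod[of "\<lambda>i x. P x * W x (ys ! i)" "size A"] length_eq
    by (simp add: output_law_def prod.list_conv_set_nth atLeast0LessThan)
  finally show ?thesis .
qed

lemma sum_permutes_prodW_le:
  fixes W :: "'x::finite \<Rightarrow> 'y \<Rightarrow> real"
  assumes W_nonneg: "\<And>x y. 0 \<le> W x y" and type: "has_type m xs P" and length_eq: "length ys = m"
  shows "(\<Sum>p\<in>{p. p permutes {..<m}}. prodW W xs (permute_list p ys))
    \<le> fact m * (1 + real m) ^ CARD('x) * prod_list (map (output_law P W) ys)" (is "?avg \<le> ?F * ?Q")
proof -
  define A where "A = mset xs"
  define q where "q = (\<Prod>a\<in>UNIV. P a ^ count A a)"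
  have xs: "length xs = m" and size_A: "size A = m" and P_eq: "P = empirical_dist A"
    using type by (auto simp: has_type_iff A_def)
  have avg_nonneg: "0 \<le> ?avg" by (auto simp: prodW_def W_nonneg intro!: sum_nonneg prod_nonneg)
  have "?avg = (\<Sum>p\<in>{p. p permutes {..<m}}. prodW W (permute_list (inv p) xs) ys)"
    using length_eq xs by (intro sum.cong refl) (simp add: prodW_permute_list)
  also have "\<dots> = (\<Sum>p\<in>{p. p permutes {..<m}}. prodW W (permute_list p xs) ys)"
    by (rule sum_permutations_inverse[symmetric])
  finally have avg: "real (card (permutations_of_multiset A)) * ?avg
      = fact m * (\<Sum>x\<in>permutations_of_multiset A. prodW W x ys)"
    using sum_permutes_permute_list[of xs "\<lambda>x. prodW W x ys"] xs by (simp add: A_def)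
  have "?avg \<le> (1 + real m) ^ CARD('x) * type_class_prob P A * ?avg"
    using mult_right_mono[OF type_class_prob_empirical_dist_ge[of A] avg_nonneg]
    by (simp add: size_A P_eq)
  also have "\<dots> = (1 + real m) ^ CARD('x) * q * (real (card (permutations_of_multiset A)) * ?avg)"
    by (simp add: type_class_prob_eq q_def mult_ac)
  also have "\<dots> = ?F * (q * (\<Sum>x\<in>permutations_of_multiset A. prodW W x ys))"
    unfolding avg by (simp only: mult_ac)
  also have "\<dots> \<le> ?F * ?Q"
    unfolding q_def
    by (intro mult_left_mono sum_type_class_prodW_le W_nonneg)
      (auto simp: P_eq size_A length_eq empirical_dist_def)
  finally show ?thesis .
qed

lemma output_law_pos:
  assumes "has_type m xs P" "stochastic W" "i < m" "0 < W (xs ! i) y"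
  shows "0 < output_law P W y"
proof -
  have P_eq: "P = empirical_dist (mset xs)" and xs: "length xs = m"
    using assms(1) by (simp_all add: has_type_iff)
  have "0 < P (xs ! i)"
    using assms(3) xs by (auto simp: P_eq empirical_dist_def count_mset_gt_0 intro!: divide_pos_pos)
  then show ?thesis
    unfolding output_law_def using assms
    by (intro sum_pos2[of _ "xs ! i"] mult_pos_pos mult_nonneg_nonneg)
      (auto simp: P_eq empirical_dist_def stochastic_nonneg)
qed

lemma prodW_eq_exp_sum_idens:
  assumes type: "has_type m xs P" and W_stochastic: "stochastic W" and ys: "length ys = m"
    and nonzero: "prodW W xs ys \<noteq> 0"
  shows "0 < prod_list (map (output_law P W) ys)"
    and "prodW W xs ys
      = exp (\<Sum>i<m. idens P W (xs ! i) (ys ! i)) * prod_list (map (output_law P W) ys)"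
proof -
  have xs: "length xs = m" using type by (simp add: has_type_iff)
  have W_pos: "0 < W (xs ! i) (ys ! i)" if "i < m" for i
    using nonzero that xs stochastic_nonneg[OF W_stochastic, of "xs ! i" "ys ! i"]
    by (auto simp: prodW_def less_le)
  have out_pos: "0 < output_law P W (ys ! i)" if "i < m" for i
    using output_law_pos[OF type W_stochastic that W_pos[OF that]] .
  have prod_out: "prod_list (map (output_law P W) ys) = (\<Prod>i<m. output_law P W (ys ! i))"
    using ys by (simp add: prod.list_conv_set_nth atLeast0LessThan)
  show pos: "0 < prod_list (map (output_law P W) ys)"
    unfolding prod_out by (intro prod_pos) (simp add: out_pos)
  have "exp (\<Sum>i<m. idens P W (xs ! i) (ys ! i))
      = (\<Prod>i<m. W (xs ! i) (ys ! i) / output_law P W (ys ! i))"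
    unfolding exp_sum[OF finite_lessThan]
    by (intro prod.cong refl) (simp add: idens_def output_law_def[symmetric] W_pos out_pos)
  also have "\<dots> = prodW W xs ys / prod_list (map (output_law P W) ys)"
    by (simp add: prod_dividef prodW_def xs prod_out)
  finally show "prodW W xs ys
      = exp (\<Sum>i<m. idens P W (xs ! i) (ys ! i)) * prod_list (map (output_law P W) ys)"
    using pos by simp
qed

subsection \<open>Maximal coding\<close>

lemma sum_UNION_le:
  fixes f :: "'a \<Rightarrow> real"
  assumes "finite \<Omega>" "finite I" "\<And>x. x \<in> \<Omega> \<Longrightarrow> 0 \<le> f x"
  shows "sum f (\<Omega> \<inter> (\<Union>i\<in>I. A i)) \<le> (\<Sum>i\<in>I. sum f (\<Omega> \<inter> A i))"
  using assms(2)
proof (induction I rule: finite_induct)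
  case (insert i I)
  have "sum f (\<Omega> \<inter> (\<Union>i\<in>insert i I. A i)) \<le> sum f (\<Omega> \<inter> A i) + sum f (\<Omega> \<inter> (\<Union>i\<in>I. A i))"
    using assms(1,3) by (auto simp: Int_Un_distrib sum_Un intro!: sum_nonneg)
  then show ?case using insert by simp
qed simp

text \<open>The average over all candidates of the error added by the codewords chosen so far is at most
  \<open>card K * N * \<beta> \<le> \<tau>\<close>, so some candidate adds at most \<open>\<tau>\<close> for all receivers at once.\<close>

lemma codebook_extension:
  fixes p :: "'k \<Rightarrow> 'c \<Rightarrow> 'y \<Rightarrow> real"
  assumes fin: "finite K" "finite C" "C \<noteq> {}" "finite \<Omega>"
    and p_nonneg: "\<And>k d y. k \<in> K \<Longrightarrow> d \<in> C \<Longrightarrow> y \<in> \<Omega> \<Longrightarrow> 0 \<le> p k d y"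
    and missed: "\<And>k d. k \<in> K \<Longrightarrow> d \<in> C \<Longrightarrow> sum (p k d) (\<Omega> - A k d) \<le> \<alpha>"
    and false_alarm: "\<And>k c. k \<in> K \<Longrightarrow> c \<in> C \<Longrightarrow> (\<Sum>d\<in>C. sum (p k d) (\<Omega> \<inter> A k c)) \<le> real (card C) * \<beta>"
    and c_mem: "\<And>i. i < N \<Longrightarrow> c i \<in> C"
    and N_le: "real (card K) * real N * \<beta> \<le> \<tau>"
  obtains d where "d \<in> C" "\<And>k. k \<in> K \<Longrightarrow> sum (p k d) (\<Omega> - (A k d - (\<Union>i<N. A k (c i)))) \<le> \<alpha> + \<tau>"
proof -
  define overlap where "overlap k d = (\<Sum>i<N. sum (p k d) (\<Omega> \<inter> A k (c i)))" for k d
  have overlap_nonneg: "0 \<le> overlap k d" if "k \<in> K" "d \<in> C" for k d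
    unfolding overlap_def using that by (auto intro!: sum_nonneg p_nonneg)
  have "(\<Sum>d\<in>C. \<Sum>k\<in>K. overlap k d) = (\<Sum>k\<in>K. \<Sum>i<N. \<Sum>d\<in>C. sum (p k d) (\<Omega> \<inter> A k (c i)))"
    unfolding overlap_def by (simp add: sum.swap[of _ C])
  also have "\<dots> \<le> (\<Sum>k\<in>K. \<Sum>i<N. real (card C) * \<beta>)"
    by (intro sum_mono false_alarm) (auto simp: c_mem)
  also have "\<dots> = real (card C) * (real (card K) * real N * \<beta>)" by simp
  also have "\<dots> \<le> (\<Sum>d\<in>C. \<tau>)" using N_le by (simp add: mult_left_mono)
  finally obtain d where d_mem: "d \<in> C" and d_overlap: "(\<Sum>k\<in>K. overlap k d) \<le> \<tau>"
    using sum_strict_mono[OF fin(2,3), of "\<lambda>_. \<tau>" "\<lambda>d. \<Sum>k\<in>K. overlap k d"] by (meson not_less)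
  have "sum (p k d) (\<Omega> - (A k d - (\<Union>i<N. A k (c i)))) \<le> \<alpha> + \<tau>" if k_mem: "k \<in> K" for k
  proof -
    have "\<Omega> - (A k d - (\<Union>i<N. A k (c i))) = (\<Omega> - A k d) \<union> \<Omega> \<inter> (\<Union>i<N. A k (c i))" by auto
    then have "sum (p k d) (\<Omega> - (A k d - (\<Union>i<N. A k (c i))))
        \<le> sum (p k d) (\<Omega> - A k d) + sum (p k d) (\<Omega> \<inter> (\<Union>i<N. A k (c i)))"
      using fin(4) p_nonneg[OF k_mem d_mem] by (auto simp: sum_Un intro!: sum_nonneg)
    also have "\<dots> \<le> \<alpha> + overlap k d"
      unfolding overlap_def by (intro add_mono missed k_mem d_mem sum_UNION_le p_nonneg fin) auto
    also have "overlap k d \<le> (\<Sum>k\<in>K. overlap k d)"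
      using k_mem by (intro member_le_sum overlap_nonneg d_mem fin) auto
    finally show ?thesis using d_overlap by simp
  qed
  with d_mem show ?thesis by (rule that)
qed

lemma maximal_codebook:
  fixes p :: "'k \<Rightarrow> 'c \<Rightarrow> 'y \<Rightarrow> real"
  assumes fin: "finite K" "finite C" "C \<noteq> {}" "finite \<Omega>"
    and p_nonneg: "\<And>k d y. k \<in> K \<Longrightarrow> d \<in> C \<Longrightarrow> y \<in> \<Omega> \<Longrightarrow> 0 \<le> p k d y"
    and missed: "\<And>k d. k \<in> K \<Longrightarrow> d \<in> C \<Longrightarrow> sum (p k d) (\<Omega> - A k d) \<le> \<alpha>"
    and false_alarm: "\<And>k c. k \<in> K \<Longrightarrow> c \<in> C \<Longrightarrow> (\<Sum>d\<in>C. sum (p k d) (\<Omega> \<inter> A k c)) \<le> real (card C) * \<beta>"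
    and \<beta>_nonneg: "0 \<le> \<beta>" and N_le: "real (card K) * real (N - 1) * \<beta> \<le> \<tau>"
  shows "\<exists>c. \<forall>j<N. c j \<in> C \<and>
    (\<forall>k\<in>K. sum (p k (c j)) (\<Omega> - disjointed (\<lambda>i. A k (c i)) j) \<le> \<alpha> + \<tau>)"
  using N_le
proof (induction N)
  case (Suc N)
  have "real (card K) * real (N - 1) * \<beta> \<le> real (card K) * real N * \<beta>"
    using \<beta>_nonneg by (intro mult_right_mono mult_left_mono) auto
  with Suc obtain c where c_mem: "\<And>j. j < N \<Longrightarrow> c j \<in> C"
    and c_err: "\<And>j k. j < N \<Longrightarrow> k \<in> K \<Longrightarrow>
      sum (p k (c j)) (\<Omega> - disjointed (\<lambda>i. A k (c i)) j) \<le> \<alpha> + \<tau>"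
    by fastforce
  have "real (card K) * real N * \<beta> \<le> \<tau>" using Suc.prems by simp
  from codebook_extension[where p = p and A = A and c = c,
      OF fin p_nonneg missed false_alarm c_mem this]
  obtain d where d_mem: "d \<in> C"
    and d_err: "\<And>k. k \<in> K \<Longrightarrow> sum (p k d) (\<Omega> - (A k d - (\<Union>i<N. A k (c i)))) \<le> \<alpha> + \<tau>"
    by auto
  have disjointed_upd: "disjointed (\<lambda>i. A k ((c(N := d)) i)) j
      = (if j = N then A k d - (\<Union>i<N. A k (c i)) else disjointed (\<lambda>i. A k (c i)) j)"
    if "j < Suc N" for j k
    using that by (auto simp: disjointed_def atLeast0LessThan)
  have "\<forall>j<Suc N. (c(N := d)) j \<in> C \<and> (\<forall>k\<in>K. sum (p k ((c(N := d)) j))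
      (\<Omega> - disjointed (\<lambda>i. A k ((c(N := d)) i)) j) \<le> \<alpha> + \<tau>)"
    using c_mem c_err d_mem d_err disjointed_upd by (auto simp: less_Suc_eq)
  then show ?case by blast
qed simp

lemma Least_disjointed: "x \<in> disjointed A n \<Longrightarrow> (LEAST i. x \<in> A i) = n"
  by (rule Least_equality) (auto simp: disjointed_def not_less[symmetric])

subsection \<open>Block sequences\<close>

definition block_space :: "nat \<Rightarrow> nat \<Rightarrow> (nat \<Rightarrow> 'a list) set" where
  "block_space L m = PiE {1..L} (\<lambda>_. {ys. length ys = m})"

definition blocks_of :: "nat \<Rightarrow> nat \<Rightarrow> 'a list \<Rightarrow> nat \<Rightarrow> 'a list" where
  "blocks_of L m ys = (\<lambda>l\<in>{1..L}. take m (drop ((l - 1) * m) ys))"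

definition block_prefix :: "(nat \<Rightarrow> 'a list) \<Rightarrow> nat \<Rightarrow> 'a list" where
  "block_prefix v l = concat (map v [1..<l])"

lemma finite_block_space: "finite (block_space L m :: (nat \<Rightarrow> 'a::finite list) set)"
  by (auto simp: block_space_def intro!: finite_PiE finite_lists_length_eq_UNIV)

lemma length_block: "v \<in> block_space L m \<Longrightarrow> l \<in> {1..L} \<Longrightarrow> length (v l) = m"
  by (auto simp: block_space_def)

lemma block_prefix_cong [fundef_cong]:
  assumes "l = l'" "\<And>j. j \<in> {1..<l'} \<Longrightarrow> v j = v' j"
  shows "block_prefix v l = block_prefix v' l'"
  unfolding block_prefix_def using assms by (intro arg_cong[of _ _ concat]) auto

lemma block_prefix_Suc_0: "block_prefix v (Suc 0) = []"
  by (simp add: block_prefix_def)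

lemma block_prefix_Suc: "1 \<le> l \<Longrightarrow> block_prefix v (Suc l) = block_prefix v l @ v l"
  by (simp add: block_prefix_def)

lemma length_block_prefix:
  assumes "\<And>j. j \<in> {1..<l} \<Longrightarrow> length (v j) = m"
  shows "length (block_prefix v l) = (l - 1) * m"
proof -
  have "map length (map v [1..<l]) = map (\<lambda>_. m) [1..<l]" using assms by auto
  then show ?thesis
    by (simp only: block_prefix_def length_concat) (simp add: sum_list_triv)
qed

lemma length_block_prefix_block_space:
  "v \<in> block_space L m \<Longrightarrow> length (block_prefix v (Suc L)) = L * m"
  using length_block_prefix[of "Suc L" v m] length_block[of v L m] by simp

lemma block_prefix_append:
  assumes "l \<le> L"
  shows "block_prefix v (Suc L) = block_prefix v (Suc l) @ concat (map v [Suc l..<Suc L])"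
proof -
  have "[1..<Suc L] = [1..<Suc l] @ [Suc l..<Suc L]"
    using assms upt_add_eq_append[of 1 "Suc l" "L - l"] by simp
  then show ?thesis by (simp only: block_prefix_def map_append concat_append)
qed

lemma nth_block_prefix_cong:
  assumes length_eq: "\<And>j. j \<in> {1..L} \<Longrightarrow> length (v j) = m"
    and eq: "\<And>j. j \<in> {1..L} \<Longrightarrow> (j - 1) * m \<le> i \<Longrightarrow> v j = v' j"
  shows "(block_prefix v (Suc L) @ zs) ! i = (block_prefix v' (Suc L) @ zs) ! i"
proof (cases "i < L * m")
  case True
  define l where "l = Suc (i div m)"
  have "0 < m" using True by (cases m) auto
  then have l_bounds: "l \<le> L" "i < l * m"
    using True dividend_less_div_times[of m i]
    by (auto simp: l_def Suc_le_eq less_mult_imp_div_less)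
  have "(j - 1) * m \<le> i" if "j \<in> {1..<Suc l}" for j
  proof -
    have "(j - 1) * m \<le> i div m * m" using that by (intro mult_right_mono) (auto simp: l_def)
    also have "\<dots> \<le> i" by (rule div_times_less_eq_dividend)
    finally show ?thesis .
  qed
  then have "block_prefix v (Suc l) = block_prefix v' (Suc l)"
    using l_bounds(1) by (intro block_prefix_cong eq) auto
  moreover have "i < length (block_prefix v (Suc l))"
    using l_bounds length_eq by (subst length_block_prefix[where m = m]) auto
  ultimately show ?thesis
    by (simp add: block_prefix_append[OF l_bounds(1)] nth_append)
next
  case False
  have "(j - 1) * m \<le> i" if "j \<in> {1..L}" for j
  proof -
    have "(j - 1) * m \<le> L * m" using that by (intro mult_right_mono) auto
    also have "L * m \<le> i" using False by simp
    finally show ?thesis .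
  qed
  then have "block_prefix v (Suc L) = block_prefix v' (Suc L)"
    by (intro block_prefix_cong eq) auto
  then show ?thesis by simp
qed

lemma block_prefix_blocks_of: "block_prefix (blocks_of L m ys) (Suc L) = take (L * m) ys"
proof -
  have "block_prefix (\<lambda>l. take m (drop ((l - 1) * m) ys)) (Suc L) = take (L * m) ys"
    by (induction L)
      (simp_all add: block_prefix_Suc_0 block_prefix_Suc take_add[symmetric] add.commute[of m])
  moreover have "block_prefix (blocks_of L m ys) (Suc L)
      = block_prefix (\<lambda>l. take m (drop ((l - 1) * m) ys)) (Suc L)"
    by (rule block_prefix_cong) (auto simp: blocks_of_def)
  ultimately show ?thesis by simp
qed

lemma blocks_of_block_prefix:
  assumes v_mem: "v \<in> block_space L m"
  shows "blocks_of L m (block_prefix v (Suc L) @ zs) = v"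
proof
  fix l
  show "blocks_of L m (block_prefix v (Suc L) @ zs) l = v l"
  proof (cases "l \<in> {1..L}")
    case True
    have "length (block_prefix v l) = (l - 1) * m"
      using True by (intro length_block_prefix length_block[OF v_mem]) auto
    moreover have "block_prefix v (Suc L) = block_prefix v l @ v l @ concat (map v [Suc l..<Suc L])"
      using True block_prefix_append[of l L v]
      by (simp only: block_prefix_Suc append_assoc atLeastAtMost_iff)
    ultimately show ?thesis
      using True length_block[OF v_mem True] by (simp add: blocks_of_def del: upt_Suc)
  next
    case False
    then show ?thesis using v_mem by (auto simp: blocks_of_def block_space_def)
  qed
qed

lemma blocks_of_in_block_space:
  assumes "L * m \<le> length ys"
  shows "blocks_of L m ys \<in> block_space L m"
proof -
  have "(l - 1) * m + m \<le> length ys" if "l \<in> {1..L}" for l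
  proof -
    have "(l - 1) * m + m = l * m" using that by (cases l) auto
    also have "\<dots> \<le> L * m" using that by simp
    finally show ?thesis using assms by simp
  qed
  then show ?thesis by (fastforce simp: blocks_of_def block_space_def)
qed

lemma blocks_of_take:
  assumes "l * m \<le> n"
  shows "blocks_of L m (take n ys) l = blocks_of L m ys l"
proof -
  have "m \<le> n - (l - 1) * m" if "1 \<le> l"
    using assms that by (cases l) auto
  then show ?thesis by (simp add: blocks_of_def drop_take min_absorb1)
qed

lemma bij_betw_blocks_of:
  "bij_betw (\<lambda>ys. (blocks_of L m ys, drop (L * m) ys)) {ys. length ys = L * m + n}
    (block_space L m \<times> {zs. length zs = n})"
  by (rule bij_betwI[where g = "\<lambda>(v, zs). block_prefix v (Suc L) @ zs"])
    (auto simp: blocks_of_in_block_space block_prefix_blocks_of blocks_of_block_prefix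
      length_block_prefix_block_space)

lemma sum_lists_blocks:
  "(\<Sum>ys\<in>{ys. length ys = L * m + n}. f (blocks_of L m ys) (drop (L * m) ys))
    = (\<Sum>v\<in>block_space L m. \<Sum>zs\<in>{zs. length zs = n}. f v zs)"
  using sum.reindex_bij_betw[OF bij_betw_blocks_of, of "\<lambda>(v, zs). f v zs" L m n]
  by (simp add: sum.cartesian_product)

lemma prodW_block_prefix:
  assumes "\<And>l. l \<in> {1..n} \<Longrightarrow> length (x l) = length (y l)"
  shows "prodW W (block_prefix x (Suc n)) (block_prefix y (Suc n))
    = (\<Prod>l\<in>{1..n}. prodW W (x l) (y l))"
  using assms
proof (induction n)
  case 0
  then show ?case by (simp add: block_prefix_Suc_0 prodW_def)
next
  case (Suc n)
  have "map (length \<circ> x) [1..<Suc n] = map (length \<circ> y) [1..<Suc n]"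
    using Suc.prems by (intro map_cong) auto
  then have "length (block_prefix x (Suc n)) = length (block_prefix y (Suc n))"
    by (simp only: block_prefix_def length_concat map_map)
  then show ?case using Suc by (simp add: block_prefix_Suc prodW_append)
qed

subsection \<open>Block permutations\<close>

definition block_permutations :: "nat \<Rightarrow> nat \<Rightarrow> (nat \<Rightarrow> nat \<Rightarrow> nat) set" where
  "block_permutations L m = PiE {1..L} (\<lambda>_. {p. p permutes {..<m}})"

definition permute_blocks :: "nat \<Rightarrow> (nat \<Rightarrow> nat \<Rightarrow> nat) \<Rightarrow> (nat \<Rightarrow> 'a list) \<Rightarrow> nat \<Rightarrow> 'a list" where
  "permute_blocks L \<pi> v = (\<lambda>l\<in>{1..L}. permute_list (\<pi> l) (v l))"

definition symmetrize :: "nat \<Rightarrow> nat \<Rightarrow> ((nat \<Rightarrow> 'a list) \<Rightarrow> real) \<Rightarrow> (nat \<Rightarrow> 'a list) \<Rightarrow> real" where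
  "symmetrize L m f v
    = (\<Sum>\<pi>\<in>block_permutations L m. f (permute_blocks L \<pi> v)) / real (card (block_permutations L m))"

lemma block_permutations_permutes: "\<pi> \<in> block_permutations L m \<Longrightarrow> l \<in> {1..L} \<Longrightarrow> \<pi> l permutes {..<m}"
  by (auto simp: block_permutations_def)

lemma finite_block_permutations: "finite (block_permutations L m)"
  by (auto simp: block_permutations_def intro!: finite_PiE finite_permutations)

lemma card_block_permutations: "card (block_permutations L m) = fact m ^ L"
  by (simp add: block_permutations_def card_PiE card_permutations)

lemma permute_blocks_in_block_space: "v \<in> block_space L m \<Longrightarrow> permute_blocks L \<pi> v \<in> block_space L m"
  by (auto simp: permute_blocks_def block_space_def)

lemma permute_blocks_inv:
  assumes \<pi>_perm: "\<pi> \<in> block_permutations L m" and v_mem: "v \<in> block_space L m"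
  shows "permute_blocks L (\<lambda>l. inv (\<pi> l)) (permute_blocks L \<pi> v) = v"
    and "permute_blocks L \<pi> (permute_blocks L (\<lambda>l. inv (\<pi> l)) v) = v"
proof -
  have "\<pi> l permutes {..<length (v l)}" if "l \<in> {1..L}" for l
    using block_permutations_permutes[OF \<pi>_perm that] length_block[OF v_mem that] by simp
  moreover have "v l = undefined" if "l \<notin> {1..L}" for l
    using v_mem that by (auto simp: block_space_def)
  ultimately show "permute_blocks L (\<lambda>l. inv (\<pi> l)) (permute_blocks L \<pi> v) = v"
    and "permute_blocks L \<pi> (permute_blocks L (\<lambda>l. inv (\<pi> l)) v) = v"
    by (auto simp: permute_blocks_def fun_eq_iff permute_list_inv)
qed

lemma bij_betw_permute_blocks:
  assumes "\<pi> \<in> block_permutations L m"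
  shows "bij_betw (permute_blocks L \<pi>) (block_space L m) (block_space L m)"
  by (rule bij_betwI[where g = "permute_blocks L (\<lambda>l. inv (\<pi> l))"])
    (auto simp: permute_blocks_in_block_space permute_blocks_inv[OF assms])

lemma sum_permute_blocks:
  assumes "\<pi> \<in> block_permutations L m"
  shows "(\<Sum>v\<in>block_space L m. f (permute_blocks L \<pi> v)) = (\<Sum>v\<in>block_space L m. f v)"
  by (rule sum.reindex_bij_betw[OF bij_betw_permute_blocks[OF assms]])

lemma permute_blocks_compose:
  assumes \<pi>_perm: "\<pi> \<in> block_permutations L m" and v_mem: "v \<in> block_space L m"
  shows "permute_blocks L \<pi> (permute_blocks L \<rho> v) = permute_blocks L (\<lambda>l\<in>{1..L}. \<rho> l \<circ> \<pi> l) v"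
  using block_permutations_permutes[OF \<pi>_perm] length_block[OF v_mem]
  by (auto simp: permute_blocks_def fun_eq_iff permute_list_compose)

lemma sum_block_permutations_compose:
  assumes \<rho>_perm: "\<rho> \<in> block_permutations L m"
  shows "(\<Sum>\<pi>\<in>block_permutations L m. f (\<lambda>l\<in>{1..L}. \<rho> l \<circ> \<pi> l)) = (\<Sum>\<pi>\<in>block_permutations L m. f \<pi>)"
proof (rule sum.reindex_bij_witness[where i = "\<lambda>\<pi>. \<lambda>l\<in>{1..L}. inv (\<rho> l) \<circ> \<pi> l"
      and j = "\<lambda>\<pi>. \<lambda>l\<in>{1..L}. \<rho> l \<circ> \<pi> l"])
  fix \<pi> assume \<pi>_perm: "\<pi> \<in> block_permutations L m"
  have perm: "\<rho> l permutes {..<m}" "\<pi> l permutes {..<m}" if "l \<in> {1..L}" for l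
    using block_permutations_permutes \<rho>_perm \<pi>_perm that by auto
  moreover have "\<pi> l = undefined" if "l \<notin> {1..L}" for l
    using \<pi>_perm that by (auto simp: block_permutations_def)
  ultimately show "(\<lambda>l\<in>{1..L}. inv (\<rho> l) \<circ> (\<lambda>l\<in>{1..L}. \<rho> l \<circ> \<pi> l) l) = \<pi>"
    and "(\<lambda>l\<in>{1..L}. \<rho> l \<circ> (\<lambda>l\<in>{1..L}. inv (\<rho> l) \<circ> \<pi> l) l) = \<pi>"
    by (fastforce simp: fun_eq_iff permutes_inverses)+
  show "(\<lambda>l\<in>{1..L}. \<rho> l \<circ> \<pi> l) \<in> block_permutations L m"
    and "(\<lambda>l\<in>{1..L}. inv (\<rho> l) \<circ> \<pi> l) \<in> block_permutations L m"
    unfolding block_permutations_def using perm by (auto intro!: permutes_compose permutes_inv)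
qed simp

lemma symmetrize_nonneg: "(\<And>v. 0 \<le> f v) \<Longrightarrow> 0 \<le> symmetrize L m f v"
  by (simp add: symmetrize_def sum_nonneg)

lemma symmetrize_permute_blocks:
  assumes \<rho>_perm: "\<rho> \<in> block_permutations L m" and v_mem: "v \<in> block_space L m"
  shows "symmetrize L m f (permute_blocks L \<rho> v) = symmetrize L m f v"
  using sum_block_permutations_compose[OF \<rho>_perm, of "\<lambda>\<pi>. f (permute_blocks L \<pi> v)"]
  by (simp add: symmetrize_def permute_blocks_compose[OF _ v_mem])

lemma sum_permute_blocks_eq_symmetrize:
  "(\<Sum>\<pi>\<in>block_permutations L m. \<Sum>v\<in>A. f (permute_blocks L \<pi> v))
    = real (card (block_permutations L m)) * (\<Sum>v\<in>A. symmetrize L m f v)"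
  by (subst sum.swap) (simp add: symmetrize_def card_block_permutations flip: sum_divide_distrib)

lemma sum_symmetrize_mult:
  fixes f g :: "(nat \<Rightarrow> 'a list) \<Rightarrow> real"
  assumes g_invariant: "\<And>\<pi> v. \<pi> \<in> block_permutations L m \<Longrightarrow> v \<in> block_space L m \<Longrightarrow>
      g (permute_blocks L \<pi> v) = g v"
  shows "(\<Sum>v\<in>block_space L m. symmetrize L m f v * g v) = (\<Sum>v\<in>block_space L m. f v * g v)"
proof -
  let ?C = "block_permutations L m"
  have "real (card ?C) * (\<Sum>v\<in>block_space L m. symmetrize L m f v * g v)
      = (\<Sum>v\<in>block_space L m. \<Sum>\<pi>\<in>?C. f (permute_blocks L \<pi> v) * g v)"
    by (simp add: symmetrize_def card_block_permutations sum_distrib_left flip: sum_distrib_right)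
  also have "\<dots> = (\<Sum>\<pi>\<in>?C. \<Sum>v\<in>block_space L m. f (permute_blocks L \<pi> v) * g (permute_blocks L \<pi> v))"
    by (subst sum.swap) (simp add: g_invariant)
  also have "\<dots> = real (card ?C) * (\<Sum>v\<in>block_space L m. f v * g v)"
    by (simp add: sum_permute_blocks[where f = "\<lambda>v. f v * g v"])
  finally show ?thesis by (simp add: card_block_permutations)
qed

subsection \<open>Feedback codes\<close>

definition channel_inputs ::
  "nat \<Rightarrow> (nat \<Rightarrow> nat \<Rightarrow> 'y list \<Rightarrow> 'y list \<Rightarrow> 'x) \<Rightarrow> nat \<Rightarrow> 'y list \<Rightarrow> 'y list \<Rightarrow> 'x list" where
  "channel_inputs n enc j y1 y2 = map (\<lambda>i. enc (Suc i) j (take i y1) (take i y2)) [0..<n]"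

lemma flf_prob_eq_prodW:
  "flf_prob W1 W2 n enc j y1 y2
    = prodW W1 (channel_inputs n enc j y1 y2) y1 * prodW W2 (channel_inputs n enc j y1 y2) y2"
  by (simp add: flf_prob_def prodW_def channel_inputs_def prod.atLeast1_atMost_eq prod.distrib)

definition flf_message_err ::
  "('x \<Rightarrow> 'y \<Rightarrow> real) \<Rightarrow> ('x \<Rightarrow> 'y \<Rightarrow> real) \<Rightarrow> nat \<Rightarrow>
   (nat \<Rightarrow> nat \<Rightarrow> 'y list \<Rightarrow> 'y list \<Rightarrow> 'x) \<Rightarrow> nat \<Rightarrow> ('y list \<Rightarrow> nat) \<Rightarrow> nat \<Rightarrow> real" where
  "flf_message_err W1 W2 n enc k g j
    = (\<Sum>y1\<in>{ys. length ys = n}. \<Sum>y2\<in>{ys. length ys = n}.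
        flf_prob W1 W2 n enc j y1 y2 * of_bool (g (if k = 1 then y1 else y2) \<noteq> j))"

lemma flf_err_le:
  assumes "1 \<le> M" and message_err: "\<And>j. j \<in> {1..M} \<Longrightarrow> flf_message_err W1 W2 n enc k g j \<le> e"
  shows "flf_err W1 W2 n M enc k g \<le> e"
proof -
  have "flf_err W1 W2 n M enc k g = (\<Sum>j\<in>{1..M}. flf_message_err W1 W2 n enc k g j) / real M"
    by (simp add: flf_err_def flf_message_err_def of_bool_def)
  also have "\<dots> \<le> (\<Sum>j\<in>{1..M}. e) / real M"
    by (intro divide_right_mono sum_mono message_err) auto
  finally show ?thesis using assms(1) by simp
qed

lemma flf_code_deterministic:
  assumes "1 \<le> M"
    and "\<And>j. j \<in> {1..M} \<Longrightarrow> flf_message_err W1 W2 n enc 1 g1 j \<le> e"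
    and "\<And>j. j \<in> {1..M} \<Longrightarrow> flf_message_err W1 W2 n enc 2 g2 j \<le> e"
  shows "flf_code W1 W2 n M e (return_pmf enc) g1 g2"
  using assms flf_err_le[OF assms(1,2)] flf_err_le[OF assms(1,3)] by (simp add: flf_code_def)

lemma ln_le_ln_ereal_Mstar_f:
  assumes "flf_code W1 W2 n M \<epsilon> Q g1 g2"
  shows "ereal (ln (real M)) \<le> ln_ereal (Mstar_f W1 W2 n \<epsilon>)"
proof -
  have M_ge: "1 \<le> M" using assms by (simp add: flf_code_def)
  have "ereal (real M) \<le> Mstar_f W1 W2 n \<epsilon>"
    unfolding Mstar_f_def using assms by (intro Sup_upper) blast
  then show ?thesis using M_ge by (cases "Mstar_f W1 W2 n \<epsilon>") (auto simp: ln_ereal_def)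
qed

lemma nf_err_nonneg: "stochastic W \<Longrightarrow> 0 \<le> nf_err W n M enc g"
  unfolding nf_err_def by (intro mult_nonneg_nonneg sum_nonneg prodW_nonneg) auto

lemma eps_star_nonneg:
  fixes W1 W2 :: "'x::finite \<Rightarrow> 'y::finite \<Rightarrow> real"
  assumes "stochastic W1"
  shows "0 \<le> eps_star W1 W2 n M"
  unfolding eps_star_def
proof (rule cInf_greatest)
  define enc :: "nat \<Rightarrow> 'x list" where "enc = (\<lambda>_. replicate n undefined)"
  define g :: "'y list \<Rightarrow> nat" where "g = (\<lambda>_. 0)"
  have "\<forall>j\<in>{1..M}. length (enc j) = n" by (simp add: enc_def)
  then show "{e. \<exists>enc g1 g2. (\<forall>j\<in>{1..M}. length (enc j) = n) \<and> nf_err W1 n M enc g1 \<le> e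
      \<and> nf_err W2 n M enc g2 \<le> e} \<noteq> {}"
    using max.cobounded1[of "nf_err W1 n M enc g"] max.cobounded2[of "nf_err W2 n M enc g"] by blast
qed (use nf_err_nonneg[OF assms] order_trans in blast)

subsection \<open>The size of the codebook\<close>

lemma power_mult_power_le_power:
  fixes a :: real
  assumes S_ge: "1 \<le> S" and a_ge: "2 \<le> a" and d_ge: "1 \<le> d"
  shows "real S ^ L * a ^ (L * d) \<le> a ^ (S * L * d)"
proof -
  have "S - 1 < 2 ^ (S - 1)" by (rule less_exp)
  then have "S \<le> 2 ^ (S - 1)" using S_ge by linarith
  then have "real S \<le> 2 ^ (S - 1)" using of_nat_mono by fastforce
  also have "\<dots> \<le> a ^ (S - 1)" using a_ge by (intro power_mono) auto
  also have "\<dots> \<le> a ^ ((S - 1) * d)" using a_ge d_ge by (intro power_increasing) auto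
  finally have "real S ^ L * a ^ (L * d) \<le> (a ^ ((S - 1) * d)) ^ L * a ^ (L * d)"
    using a_ge by (intro mult_right_mono power_mono) auto
  also have "\<dots> = a ^ (((S - 1) * d) * L + L * d)" by (simp add: power_mult power_add)
  also have "((S - 1) * d) * L + L * d = S * L * d"
    using S_ge by (cases S) (auto simp: algebra_simps)
  finally show ?thesis .
qed

lemma codebook_size_le:
  fixes a :: real
  assumes S_ge: "1 \<le> S" and a_ge: "2 \<le> a" and d_ge: "1 \<le> d" and \<tau>_pos: "0 < \<tau>"
  shows "2 * exp (\<gamma> + (ln (\<tau> / 2) - real S * real L * real d * ln a - real L * ln (real S) - \<zeta>))
      * (real S ^ L * (real S ^ L * a ^ (L * d))) \<le> \<tau> * exp (\<gamma> - \<zeta>)" (is "2 * exp ?t * _ \<le> _")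
proof -
  have "exp (real S * real L * real d * ln a) = a ^ (S * L * d)"
    using a_ge exp_of_nat_mult[of "S * L * d" "ln a"] by simp
  moreover have "exp (real L * ln (real S)) = real S ^ L"
    using S_ge by (simp add: exp_of_nat_mult)
  ultimately have "exp ?t * (real S ^ L * a ^ (S * L * d))
      = exp (?t + (real L * ln (real S) + real S * real L * real d * ln a))"
    by (simp only: exp_add)
  also have "\<dots> = exp (ln (\<tau> / 2) + (\<gamma> - \<zeta>))" by simp
  also have "\<dots> = \<tau> / 2 * exp (\<gamma> - \<zeta>)" using \<tau>_pos by (simp add: exp_add)
  finally have size: "2 * exp ?t * (real S ^ L * a ^ (S * L * d)) = \<tau> * exp (\<gamma> - \<zeta>)" by simp
  have "2 * exp ?t * (real S ^ L * (real S ^ L * a ^ (L * d)))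
      \<le> 2 * exp ?t * (real S ^ L * a ^ (S * L * d))"
    by (intro mult_left_mono power_mult_power_le_power[OF S_ge a_ge d_ge]) auto
  then show ?thesis unfolding size .
qed

subsection \<open>Feedback schemes\<close>

locale feedback_scheme =
  fixes W1 W2 :: "'x::finite \<Rightarrow> 'y::finite \<Rightarrow> real"
    and S L m :: nat
    and P :: "nat \<Rightarrow> 'x \<Rightarrow> real"
    and h :: "nat \<Rightarrow> 'x list \<Rightarrow> 'y list \<Rightarrow> 'y list \<Rightarrow> nat"
    and xx :: "nat \<Rightarrow> nat \<Rightarrow> 'x list"
  assumes W1: "stochastic W1" and W2: "stochastic W2"
    and h: "\<And>l xs ys1 ys2. \<lbrakk>l \<in> {1..L}; length xs = (l - 1) * m; length ys1 = (l - 1) * m;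
              length ys2 = (l - 1) * m\<rbrakk> \<Longrightarrow> h l xs ys1 ys2 \<in> {1..S}"
    and xx: "in_F S L m P xx"
begin

text \<open>Receivers are numbered as in \<open>tail_prob\<close>: 1 is the first one, any other number the second.\<close>

definition channel :: "nat \<Rightarrow> 'x \<Rightarrow> 'y \<Rightarrow> real" where
  "channel k = (if k = 1 then W1 else W2)"

definition output_of :: "nat \<Rightarrow> 'a \<times> 'a \<Rightarrow> 'a" where
  "output_of k \<omega> = (if k = 1 then fst \<omega> else snd \<omega>)"

abbreviation outputs :: "(nat \<Rightarrow> 'y list) set" where
  "outputs \<equiv> block_space L m"

abbreviation paths :: "(nat \<Rightarrow> nat) set" where
  "paths \<equiv> Bspace S L"

definition type_factor :: real where
  "type_factor = (1 + real m) ^ (L * CARD('x))"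

lemma type_factor_pos: "0 < type_factor"
  by (simp add: type_factor_def)

lemma stochastic_channel: "stochastic (channel k)"
  using W1 W2 by (simp add: channel_def)

lemma has_type_xx: "l \<in> {1..L} \<Longrightarrow> s \<in> {1..S} \<Longrightarrow> has_type m (xx l s) (P s)"
  using xx by (simp add: in_F_def)

lemma length_xx: "l \<in> {1..L} \<Longrightarrow> s \<in> {1..S} \<Longrightarrow> length (xx l s) = m"
  using has_type_xx by (auto simp: has_type_def)

lemma finite_paths: "finite paths"
  by (auto simp: Bspace_def intro!: finite_PiE)

lemma card_paths: "card paths = S ^ L"
  by (simp add: Bspace_def card_PiE)

lemma path_range: "b \<in> paths \<Longrightarrow> l \<in> {1..L} \<Longrightarrow> b l \<in> {1..S}"
  by (auto simp: Bspace_def)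

lemma length_xx_path: "b \<in> paths \<Longrightarrow> l \<in> {1..L} \<Longrightarrow> length (xx l (b l)) = m"
  using path_range length_xx by blast

subsubsection \<open>The path selected by the outputs\<close>

function path_rec :: "(nat \<Rightarrow> 'y list) \<Rightarrow> (nat \<Rightarrow> 'y list) \<Rightarrow> nat \<Rightarrow> nat" where
  "path_rec v1 v2 l = h l (block_prefix (\<lambda>j. xx j (path_rec v1 v2 j)) l)
     (block_prefix v1 l) (block_prefix v2 l)"
  by pat_completeness auto
termination
  by (relation "Wellfounded.measure (\<lambda>(_, _, l). l)") auto

declare path_rec.simps [simp del]

definition path_of :: "(nat \<Rightarrow> 'y list) \<times> (nat \<Rightarrow> 'y list) \<Rightarrow> nat \<Rightarrow> nat" where
  "path_of \<omega> = restrict (path_rec (fst \<omega>) (snd \<omega>)) {1..L}"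

lemma path_rec_causal:
  assumes "\<And>j. j \<in> {1..<l} \<Longrightarrow> v1 j = v1' j" "\<And>j. j \<in> {1..<l} \<Longrightarrow> v2 j = v2' j"
  shows "path_rec v1 v2 l = path_rec v1' v2' l"
  using assms
proof (induction l rule: less_induct)
  case (less l)
  have "block_prefix (\<lambda>j. xx j (path_rec v1 v2 j)) l
      = block_prefix (\<lambda>j. xx j (path_rec v1' v2' j)) l"
    using less by (intro block_prefix_cong) auto
  moreover have "block_prefix v1 l = block_prefix v1' l" "block_prefix v2 l = block_prefix v2' l"
    using less.prems by (auto intro!: block_prefix_cong)
  ultimately show ?case by (simp only: path_rec.simps[of v1 v2 l] path_rec.simps[of v1' v2' l])
qed

lemma path_rec_range:
  assumes "l \<in> {1..L}"
    and "\<And>j. j \<in> {1..<l} \<Longrightarrow> length (v1 j) = m" "\<And>j. j \<in> {1..<l} \<Longrightarrow> length (v2 j) = m"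
  shows "path_rec v1 v2 l \<in> {1..S}"
  using assms
proof (induction l rule: less_induct)
  case (less l)
  have "length (xx j (path_rec v1 v2 j)) = m" if "j \<in> {1..<l}" for j
    using that less.prems by (intro length_xx less.IH) auto
  then show ?case
    unfolding path_rec.simps[of v1 v2 l] using less.prems by (intro h length_block_prefix) auto
qed

lemma path_of_in_paths: "\<omega> \<in> outputs \<times> outputs \<Longrightarrow> path_of \<omega> \<in> paths"
  unfolding path_of_def Bspace_def
  by (intro restrict_PiE_iff[THEN iffD2] ballI path_rec_range) (auto simp: length_block)

lemma path_of_eq_iff:
  assumes "b \<in> paths"
  shows "path_of \<omega> = b \<longleftrightarrow>
    (\<forall>l\<in>{1..L}. h l (xprefix xx l b) (block_prefix (fst \<omega>) l) (block_prefix (snd \<omega>) l) = b l)"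
    (is "_ \<longleftrightarrow> (\<forall>l\<in>_. ?h l = b l)")
proof
  assume "path_of \<omega> = b"
  then have b_eq: "b l = path_rec (fst \<omega>) (snd \<omega>) l" if "l \<in> {1..L}" for l
    using that by (auto simp: path_of_def)
  show "\<forall>l\<in>{1..L}. ?h l = b l"
  proof
    fix l assume l_range: "l \<in> {1..L}"
    have "xprefix xx l b = block_prefix (\<lambda>j. xx j (path_rec (fst \<omega>) (snd \<omega>) j)) l"
      unfolding xprefix_def block_prefix_def[symmetric]
      using l_range b_eq by (intro block_prefix_cong) auto
    then show "?h l = b l"
      unfolding b_eq[OF l_range] by (simp only: path_rec.simps[of "fst \<omega>" "snd \<omega>" l])
  qed
next
  assume consistent: "\<forall>l\<in>{1..L}. ?h l = b l"
  have "path_rec (fst \<omega>) (snd \<omega>) l = b l" if "l \<in> {1..L}" for l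
    using that
  proof (induction l rule: less_induct)
    case (less l)
    have "block_prefix (\<lambda>j. xx j (path_rec (fst \<omega>) (snd \<omega>) j)) l = xprefix xx l b"
      unfolding xprefix_def block_prefix_def[symmetric] using less by (intro block_prefix_cong) auto
    then show ?case using consistent less.prems by (subst path_rec.simps) simp
  qed
  then show "path_of \<omega> = b"
    using assms by (auto simp: path_of_def Bspace_def PiE_def extensional_def fun_eq_iff)
qed

subsubsection \<open>Output laws\<close>

definition path_likelihood :: "('x \<Rightarrow> 'y \<Rightarrow> real) \<Rightarrow> (nat \<Rightarrow> nat) \<Rightarrow> (nat \<Rightarrow> 'y list) \<Rightarrow> real" where
  "path_likelihood W b v = (\<Prod>l\<in>{1..L}. prodW W (xx l (b l)) (v l))"

definition memoryless_law :: "('x \<Rightarrow> 'y \<Rightarrow> real) \<Rightarrow> (nat \<Rightarrow> nat) \<Rightarrow> (nat \<Rightarrow> 'y list) \<Rightarrow> real" where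
  "memoryless_law W b v = (\<Prod>l\<in>{1..L}. prod_list (map (output_law (P (b l)) W) (v l)))"

definition joint_law :: "(nat \<Rightarrow> 'y list) \<times> (nat \<Rightarrow> 'y list) \<Rightarrow> real" where
  "joint_law \<omega> = path_likelihood W1 (path_of \<omega>) (fst \<omega>) * path_likelihood W2 (path_of \<omega>) (snd \<omega>)"

definition receiver_path_law :: "nat \<Rightarrow> (nat \<Rightarrow> nat) \<Rightarrow> (nat \<Rightarrow> 'y list) \<Rightarrow> real" where
  "receiver_path_law k b v
    = (\<Sum>\<omega>\<in>{\<omega> \<in> outputs \<times> outputs. path_of \<omega> = b \<and> output_of k \<omega> = v}. joint_law \<omega>)"

definition receiver_law :: "nat \<Rightarrow> (nat \<Rightarrow> 'y list) \<Rightarrow> real" where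
  "receiver_law k v = (\<Sum>b\<in>paths. receiver_path_law k b v)"

lemma path_likelihood_nonneg: "stochastic W \<Longrightarrow> 0 \<le> path_likelihood W b v"
  unfolding path_likelihood_def by (intro prod_nonneg ballI prodW_nonneg)

lemma joint_law_nonneg: "0 \<le> joint_law \<omega>"
  unfolding joint_law_def by (intro mult_nonneg_nonneg path_likelihood_nonneg W1 W2)

lemma receiver_path_law_nonneg: "0 \<le> receiver_path_law k b v"
  unfolding receiver_path_law_def by (intro sum_nonneg joint_law_nonneg)

lemma receiver_law_nonneg: "0 \<le> receiver_law k v"
  unfolding receiver_law_def by (intro sum_nonneg receiver_path_law_nonneg)

lemma sum_path_likelihood:
  assumes "stochastic W" "b \<in> paths"
  shows "(\<Sum>v\<in>outputs. path_likelihood W b v) = 1"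
  unfolding block_space_def path_likelihood_def
  by (subst prod_sum_PiE[symmetric])
    (auto simp: finite_lists_length_eq_UNIV
      intro!: prod.neutral sum_prodW length_xx_path assms)

lemma sum_block_space_Suc:
  fixes f :: "(nat \<Rightarrow> 'a list) \<Rightarrow> real"
  shows "(\<Sum>v\<in>block_space (Suc n) m. f v)
    = (\<Sum>v\<in>block_space n m. \<Sum>ys\<in>{ys. length ys = m}. f (v(Suc n := ys)))"
  unfolding block_space_def by (rule sum_PiE_atLeastAtMost_Suc)

definition causal_law :: "nat \<Rightarrow> (nat \<Rightarrow> 'y list) \<Rightarrow> (nat \<Rightarrow> 'y list) \<Rightarrow> real" where
  "causal_law n v1 v2 = (\<Prod>l\<in>{1..n}. prodW W1 (xx l (path_rec v1 v2 l)) (v1 l)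
      * prodW W2 (xx l (path_rec v1 v2 l)) (v2 l))"

lemma sum_causal_law_last_block:
  assumes n_less: "n < L" and v_mem: "v1 \<in> block_space n m" "v2 \<in> block_space n m"
  shows "(\<Sum>y1\<in>{ys. length ys = m}. \<Sum>y2\<in>{ys. length ys = m}.
      causal_law (Suc n) (v1(Suc n := y1)) (v2(Suc n := y2))) = causal_law n v1 v2"
proof -
  define x where "x = xx (Suc n) (path_rec v1 v2 (Suc n))"
  have causal: "path_rec (v1(Suc n := y1)) (v2(Suc n := y2)) l = path_rec v1 v2 l"
    if "l \<le> Suc n" for y1 y2 l
    using that by (intro path_rec_causal) auto
  have "length x = m"
    unfolding x_def using n_less v_mem by (intro length_xx path_rec_range) (auto simp: length_block)
  then have "(\<Sum>ys\<in>{ys. length ys = m}. prodW W x ys) = 1"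
    if "stochastic W" for W :: "'x \<Rightarrow> 'y \<Rightarrow> real"
    using that by (simp add: sum_prodW)
  moreover have "causal_law n (v1(Suc n := y1)) (v2(Suc n := y2)) = causal_law n v1 v2" for y1 y2
    unfolding causal_law_def by (intro prod.cong refl) (simp add: causal)
  then have "causal_law (Suc n) (v1(Suc n := y1)) (v2(Suc n := y2))
      = causal_law n v1 v2 * (prodW W1 x y1 * prodW W2 x y2)" for y1 y2
    by (simp add: causal_law_def causal x_def)
  ultimately show ?thesis by (simp add: W1 W2 sum_distrib_left[symmetric])
qed

lemma sum_causal_law:
  assumes "n \<le> L"
  shows "(\<Sum>v1\<in>block_space n m. \<Sum>v2\<in>block_space n m. causal_law n v1 v2) = 1"
  using assms
proof (induction n)
  case 0
  then show ?case by (simp add: block_space_def causal_law_def)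
next
  case (Suc n)
  have "(\<Sum>v1\<in>block_space (Suc n) m. \<Sum>v2\<in>block_space (Suc n) m. causal_law (Suc n) v1 v2)
      = (\<Sum>v1\<in>block_space n m. \<Sum>v2\<in>block_space n m. \<Sum>y1\<in>{ys. length ys = m}. \<Sum>y2\<in>{ys. length ys = m}.
          causal_law (Suc n) (v1(Suc n := y1)) (v2(Suc n := y2)))"
    unfolding sum_block_space_Suc by (intro sum.cong refl sum.swap)
  also have "\<dots> = (\<Sum>v1\<in>block_space n m. \<Sum>v2\<in>block_space n m. causal_law n v1 v2)"
    using Suc.prems by (intro sum.cong refl sum_causal_law_last_block) auto
  finally show ?case using Suc by simp
qed

lemma sum_joint_law: "(\<Sum>\<omega>\<in>outputs \<times> outputs. joint_law \<omega>) = 1"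
proof -
  have "joint_law (v1, v2) = causal_law L v1 v2" for v1 v2
    by (simp add: joint_law_def path_likelihood_def path_of_def causal_law_def prod.distrib)
  then show ?thesis
    using sum_causal_law[OF order_refl] by (simp add: sum.cartesian_product')
qed

lemma sum_receiver_path_law_mult:
  "(\<Sum>b\<in>paths. \<Sum>v\<in>outputs. receiver_path_law k b v * f b v)
    = (\<Sum>\<omega>\<in>outputs \<times> outputs. joint_law \<omega> * f (path_of \<omega>) (output_of k \<omega>))"
proof -
  have "receiver_path_law k b v * f b v
      = (\<Sum>\<omega>\<in>{\<omega> \<in> outputs \<times> outputs. (path_of \<omega>, output_of k \<omega>) = (b, v)}.
          joint_law \<omega> * f (path_of \<omega>) (output_of k \<omega>))" for b v
    by (simp add: receiver_path_law_def sum_distrib_right)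
  then have "(\<Sum>b\<in>paths. \<Sum>v\<in>outputs. receiver_path_law k b v * f b v)
      = (\<Sum>(b, v)\<in>paths \<times> outputs. \<Sum>\<omega>\<in>{\<omega> \<in> outputs \<times> outputs. (path_of \<omega>, output_of k \<omega>) = (b, v)}.
          joint_law \<omega> * f (path_of \<omega>) (output_of k \<omega>))"
    by (simp add: sum.cartesian_product)
  also have "\<dots> = (\<Sum>\<omega>\<in>outputs \<times> outputs. joint_law \<omega> * f (path_of \<omega>) (output_of k \<omega>))"
    unfolding case_prod_unfold prod.collapse
    by (rule sum.group)
      (auto simp: finite_block_space finite_paths path_of_in_paths output_of_def)
  finally show ?thesis .
qed

lemma receiver_path_law_le:
  assumes b_path: "b \<in> paths" and v_mem: "v \<in> outputs"
  shows "receiver_path_law k b v \<le> path_likelihood (channel k) b v"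
proof -
  let ?w = "\<lambda>\<omega>. path_likelihood W1 b (fst \<omega>) * path_likelihood W2 b (snd \<omega>)"
  have "receiver_path_law k b v \<le> (\<Sum>\<omega>\<in>{\<omega> \<in> outputs \<times> outputs. output_of k \<omega> = v}. ?w \<omega>)"
    unfolding receiver_path_law_def joint_law_def
    by (rule order_trans[OF eq_refl sum_mono2])
      (auto simp: finite_block_space path_likelihood_nonneg W1 W2)
  also have "\<dots> = path_likelihood (channel k) b v"
  proof (cases "k = 1")
    case True
    then have "{\<omega> \<in> outputs \<times> outputs. output_of k \<omega> = v} = {v} \<times> outputs"
      using v_mem by (auto simp: output_of_def)
    then show ?thesis
      using True by (simp add: sum.cartesian_product' channel_def sum_path_likelihood[OF W2 b_path]
          flip: sum_distrib_left)
  next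
    case False
    then have "{\<omega> \<in> outputs \<times> outputs. output_of k \<omega> = v} = outputs \<times> {v}"
      using v_mem by (auto simp: output_of_def)
    then show ?thesis
      using False by (simp add: sum.cartesian_product' channel_def sum_path_likelihood[OF W1 b_path]
          flip: sum_distrib_right)
  qed
  finally show ?thesis .
qed

subsubsection \<open>The tail of the information density\<close>

definition select_path :: "(nat \<Rightarrow> nat) \<Rightarrow> (nat \<times> nat \<Rightarrow> 'y list) \<Rightarrow> nat \<Rightarrow> 'y list" where
  "select_path b yy = (\<lambda>l\<in>{1..L}. yy (l, b l))"

definition array_likelihood :: "('x \<Rightarrow> 'y \<Rightarrow> real) \<Rightarrow> (nat \<times> nat \<Rightarrow> 'y list) \<Rightarrow> real" where
  "array_likelihood W yy = (\<Prod>z\<in>{1..L} \<times> {1..S}. prodW W (xx (fst z) (snd z)) (yy z))"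

definition path_idens :: "('x \<Rightarrow> 'y \<Rightarrow> real) \<Rightarrow> (nat \<Rightarrow> nat) \<Rightarrow> (nat \<Rightarrow> 'y list) \<Rightarrow> real" where
  "path_idens W b v = (\<Sum>l\<in>{1..L}. \<Sum>i<m. idens (P (b l)) W (xx l (b l) ! i) (v l ! i))"

lemma joint_pmf_eq:
  assumes "b \<in> paths"
  shows "joint_pmf W1 W2 S L h xx yy1 yy2 b = array_likelihood W1 yy1 * array_likelihood W2 yy2
    * of_bool (path_of (select_path b yy1, select_path b yy2) = b)"
proof -
  have "yprefix yy l b = block_prefix (select_path b yy) l" if "l \<in> {1..L}" for yy l
    unfolding yprefix_def block_prefix_def[symmetric] using that
    by (intro block_prefix_cong) (auto simp: select_path_def)
  then have "(\<Prod>l\<in>{1..L}.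
        if h l (xprefix xx l b) (yprefix yy1 l b) (yprefix yy2 l b) = b l then 1 else 0)
      = (of_bool (path_of (select_path b yy1, select_path b yy2) = b) :: real)"
    unfolding path_of_eq_iff[OF assms] by (auto simp: prod_zero_iff)
  then show ?thesis
    by (simp add: joint_pmf_def array_likelihood_def prod.distrib prod.cartesian_product
        case_prod_unfold)
qed

lemma idens_total_eq_path_idens:
  "idens_total L m P W xx yy b = path_idens W b (select_path b yy)"
  by (simp add: idens_total_def path_idens_def select_path_def)

lemma sum_array_likelihood:
  assumes W_stochastic: "stochastic W" and b_path: "b \<in> paths"
  shows "(\<Sum>yy\<in>Yspace S L m. array_likelihood W yy * f (select_path b yy))
    = (\<Sum>v\<in>outputs. path_likelihood W b v * f v)"
proof -
  have "(\<lambda>l. (l, b l)) ` {1..L} \<subseteq> {1..L} \<times> {1..S}" using path_range[OF b_path] by auto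
  moreover have "inj_on (\<lambda>l. (l, b l)) {1..L}" by (auto simp: inj_on_def)
  ultimately show ?thesis
    using sum_PiE_marginal[of "{1..L} \<times> {1..S}" "\<lambda>_. {ys. length ys = m}"
        "\<lambda>z. prodW W (xx (fst z) (snd z))" "\<lambda>l. (l, b l)" "{1..L}" f]
    by (auto simp: Yspace_def block_space_def array_likelihood_def path_likelihood_def
        select_path_def o_def finite_lists_length_eq_UNIV sum_prodW[OF W_stochastic length_xx])
qed

lemma sum_joint_pmf_mult:
  "(\<Sum>yy1\<in>Yspace S L m. \<Sum>yy2\<in>Yspace S L m. \<Sum>b\<in>paths.
      joint_pmf W1 W2 S L h xx yy1 yy2 b * f b (select_path b yy1) (select_path b yy2))
    = (\<Sum>\<omega>\<in>outputs \<times> outputs. joint_law \<omega> * f (path_of \<omega>) (fst \<omega>) (snd \<omega>))"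
proof -
  let ?Y = "Yspace S L m :: (nat \<times> nat \<Rightarrow> 'y list) set"
  let ?F = "\<lambda>b v1 v2. of_bool (path_of (v1, v2) = b) * f b v1 v2 :: real"
  have "(\<Sum>yy1\<in>?Y. \<Sum>yy2\<in>?Y. \<Sum>b\<in>paths.
        joint_pmf W1 W2 S L h xx yy1 yy2 b * f b (select_path b yy1) (select_path b yy2))
      = (\<Sum>b\<in>paths. \<Sum>yy1\<in>?Y. array_likelihood W1 yy1 * (\<Sum>yy2\<in>?Y. array_likelihood W2 yy2
          * ?F b (select_path b yy1) (select_path b yy2)))"
    by (simp add: sum.swap[of _ paths] joint_pmf_eq sum_distrib_left mult.assoc
        cong: sum.cong)
  also have "\<dots> = (\<Sum>b\<in>paths. \<Sum>v1\<in>outputs. path_likelihood W1 b v1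
      * (\<Sum>v2\<in>outputs. path_likelihood W2 b v2 * ?F b v1 v2))"
    by (intro sum.cong refl)
      (simp only: sum_array_likelihood[OF W2, where f = "?F _ _"]
        sum_array_likelihood[OF W1, where f = "\<lambda>v1. \<Sum>v2\<in>outputs. _ v2 * ?F _ v1 v2"])
  also have "\<dots> = (\<Sum>\<omega>\<in>outputs \<times> outputs. \<Sum>b\<in>paths. if b = path_of \<omega>
      then path_likelihood W1 b (fst \<omega>) * path_likelihood W2 b (snd \<omega>) * f b (fst \<omega>) (snd \<omega>)
      else 0)"
    by (subst sum.swap) (auto simp: sum.cartesian_product' sum_distrib_left intro!: sum.cong)
  also have "\<dots> = (\<Sum>\<omega>\<in>outputs \<times> outputs. joint_law \<omega> * f (path_of \<omega>) (fst \<omega>) (snd \<omega>))"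
    by (intro sum.cong refl) (simp add: finite_paths path_of_in_paths joint_law_def)
  finally show ?thesis .
qed

lemma tail_prob_eq:
  "tail_prob W1 W2 S L m P h xx k \<gamma>
    = (\<Sum>b\<in>paths. \<Sum>v\<in>outputs. receiver_path_law k b v * of_bool (path_idens (channel k) b v \<le> \<gamma>))"
proof -
  let ?low = "\<lambda>b v1 v2. of_bool (path_idens (channel k) b (output_of k (v1, v2)) \<le> \<gamma>) :: real"
  have "tail_prob W1 W2 S L m P h xx k \<gamma> = (\<Sum>yy1\<in>Yspace S L m. \<Sum>yy2\<in>Yspace S L m. \<Sum>b\<in>paths.
      joint_pmf W1 W2 S L h xx yy1 yy2 b * ?low b (select_path b yy1) (select_path b yy2))"
    unfolding tail_prob_def
    by (intro sum.cong refl) (auto simp: idens_total_eq_path_idens channel_def output_of_def)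
  then show ?thesis
    unfolding sum_joint_pmf_mult[where f = ?low] sum_receiver_path_law_mult by simp
qed

lemma path_likelihood_eq_exp_path_idens:
  assumes W_stochastic: "stochastic W" and b_path: "b \<in> paths" and v_mem: "v \<in> outputs"
    and nonzero: "path_likelihood W b v \<noteq> 0"
  shows "0 < memoryless_law W b v"
    and "path_likelihood W b v = exp (path_idens W b v) * memoryless_law W b v"
proof -
  have block_nz: "prodW W (xx l (b l)) (v l) \<noteq> 0" if "l \<in> {1..L}" for l
    using nonzero that by (auto simp: path_likelihood_def)
  note block = prodW_eq_exp_sum_idens[OF has_type_xx[OF _ path_range[OF b_path]] W_stochastic
      length_block[OF v_mem] block_nz]
  show "0 < memoryless_law W b v"
    unfolding memoryless_law_def by (intro prod_pos ballI block(1))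
  show "path_likelihood W b v = exp (path_idens W b v) * memoryless_law W b v"
    unfolding path_likelihood_def path_idens_def memoryless_law_def
      exp_sum[OF finite_atLeastAtMost] prod.distrib[symmetric]
    by (intro prod.cong refl block(2))
qed

lemma low_likelihood_prob_le:
  "(\<Sum>b\<in>paths. \<Sum>v\<in>outputs. receiver_path_law k b v
      * of_bool (path_likelihood (channel k) b v \<le> exp \<gamma> * memoryless_law (channel k) b v))
    \<le> tail_prob W1 W2 S L m P h xx k \<gamma>"
  unfolding tail_prob_eq
proof (intro sum_mono)
  fix b v assume b_path: "b \<in> paths" and v_mem: "v \<in> outputs"
  show "receiver_path_law k b v
        * of_bool (path_likelihood (channel k) b v \<le> exp \<gamma> * memoryless_law (channel k) b v)
      \<le> receiver_path_law k b v * of_bool (path_idens (channel k) b v \<le> \<gamma>)"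
  proof (cases "path_likelihood (channel k) b v = 0")
    case True
    then show ?thesis
      using receiver_path_law_le[OF b_path v_mem, of k] receiver_path_law_nonneg[of k b v] by simp
  next
    case False
    from path_likelihood_eq_exp_path_idens[OF stochastic_channel b_path v_mem this]
    show ?thesis by simp
  qed
qed

subsubsection \<open>Random block permutations\<close>

definition mixture :: "nat \<Rightarrow> (nat \<Rightarrow> 'y list) \<Rightarrow> real" where
  "mixture k = symmetrize L m (receiver_law k)"

lemma mixture_nonneg: "0 \<le> mixture k v"
  unfolding mixture_def by (intro symmetrize_nonneg receiver_law_nonneg)

lemma mixture_permute_blocks:
  "\<pi> \<in> block_permutations L m \<Longrightarrow> v \<in> outputs \<Longrightarrow> mixture k (permute_blocks L \<pi> v) = mixture k v"
  unfolding mixture_def by (rule symmetrize_permute_blocks)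

lemma sum_mixture: "(\<Sum>v\<in>outputs. mixture k v) = 1"
proof -
  have "(\<Sum>v\<in>outputs. mixture k v) = (\<Sum>v\<in>outputs. receiver_law k v)"
    using sum_symmetrize_mult[of L m "\<lambda>_. 1" "receiver_law k"] by (simp add: mixture_def)
  also have "\<dots> = (\<Sum>b\<in>paths. \<Sum>v\<in>outputs. receiver_path_law k b v)"
    unfolding receiver_law_def by (rule sum.swap)
  finally show ?thesis
    using sum_receiver_path_law_mult[of k "\<lambda>_ _. 1"] by (simp add: sum_joint_law)
qed

lemma memoryless_law_permute_blocks:
  assumes "\<pi> \<in> block_permutations L m" "v \<in> outputs"
  shows "memoryless_law W b (permute_blocks L \<pi> v) = memoryless_law W b v"
  unfolding memoryless_law_def
proof (rule prod.cong[OF refl])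
  fix l assume "l \<in> {1..L}"
  then have "mset (permute_blocks L \<pi> v l) = mset (v l)"
    using block_permutations_permutes[OF assms(1)] length_block[OF assms(2)]
    by (simp add: permute_blocks_def)
  then show "prod_list (map f (permute_blocks L \<pi> v l)) = prod_list (map f (v l))"
    for f :: "'y \<Rightarrow> real"
    by (simp only: prod_mset_prod_list[symmetric] mset_map)
qed

lemma symmetrize_path_likelihood_le:
  assumes W_stochastic: "stochastic W" and b_path: "b \<in> paths" and v_mem: "v \<in> outputs"
  shows "symmetrize L m (path_likelihood W b) v \<le> type_factor * memoryless_law W b v"
proof -
  have "(\<Sum>\<pi>\<in>block_permutations L m. path_likelihood W b (permute_blocks L \<pi> v))
      = (\<Prod>l\<in>{1..L}. \<Sum>p\<in>{p. p permutes {..<m}}. prodW W (xx l (b l)) (permute_list p (v l)))"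
    unfolding block_permutations_def path_likelihood_def
    by (subst prod_sum_PiE) (auto simp: finite_permutations permute_blocks_def)
  also have "\<dots> \<le> (\<Prod>l\<in>{1..L}. fact m * (1 + real m) ^ CARD('x)
      * prod_list (map (output_law (P (b l)) W) (v l)))"
    by (intro prod_mono conjI sum_nonneg prodW_nonneg sum_permutes_prodW_le stochastic_nonneg
        W_stochastic
        has_type_xx path_range[OF b_path] length_block[OF v_mem])
  also have "\<dots> = real (card (block_permutations L m))
      * (type_factor * memoryless_law W b v)"
    by (simp add: prod.distrib memoryless_law_def card_block_permutations type_factor_def power_mult
        power_mult_distrib mult.commute[of L])
  finally show ?thesis
    by (simp add: symmetrize_def card_block_permutations divide_le_eq mult.commute)
qed

lemma symmetrize_receiver_path_law_le:
  assumes b_path: "b \<in> paths" and v_mem: "v \<in> outputs"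
  shows "symmetrize L m (receiver_path_law k b) v
    \<le> type_factor * memoryless_law (channel k) b v"
proof -
  have "symmetrize L m (receiver_path_law k b) v \<le> symmetrize L m (path_likelihood (channel k) b) v"
    unfolding symmetrize_def
    by (intro divide_right_mono sum_mono receiver_path_law_le b_path permute_blocks_in_block_space
        v_mem)
      simp
  also have "\<dots> \<le> type_factor * memoryless_law (channel k) b v"
    by (rule symmetrize_path_likelihood_le[OF stochastic_channel b_path v_mem])
  finally show ?thesis .
qed

text \<open>The event is invariant under block permutations, so its probability does not change when the
  law is symmetrized.\<close>

lemma large_mixture_prob_le:
  assumes "0 \<le> \<eta>"
  shows "(\<Sum>b\<in>paths. \<Sum>v\<in>outputs. receiver_path_law k b v
      * of_bool (memoryless_law (channel k) b v \<le> \<eta> * mixture k v))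
    \<le> real S ^ L * (type_factor * \<eta>)" (is "?prob \<le> _")
proof -
  have "(\<Sum>v\<in>outputs. receiver_path_law k b v
      * of_bool (memoryless_law (channel k) b v \<le> \<eta> * mixture k v)) \<le> type_factor * \<eta>"
    if b_path: "b \<in> paths" for b
  proof -
    let ?E = "\<lambda>v. memoryless_law (channel k) b v \<le> \<eta> * mixture k v"
    have "(\<Sum>v\<in>outputs. receiver_path_law k b v * of_bool (?E v))
        = (\<Sum>v\<in>outputs. symmetrize L m (receiver_path_law k b) v * of_bool (?E v))"
      by (rule sum_symmetrize_mult[symmetric])
        (simp add: memoryless_law_permute_blocks mixture_permute_blocks)
    also have "\<dots> \<le> (\<Sum>v\<in>outputs. type_factor * \<eta> * mixture k v)"
    proof (rule sum_mono)
      fix v assume v_mem: "v \<in> outputs"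
      show "symmetrize L m (receiver_path_law k b) v * of_bool (?E v)
          \<le> type_factor * \<eta> * mixture k v"
      proof (cases "?E v")
        case True
        have "symmetrize L m (receiver_path_law k b) v
            \<le> type_factor * memoryless_law (channel k) b v"
          by (rule symmetrize_receiver_path_law_le[OF b_path v_mem])
        also have "\<dots> \<le> type_factor * (\<eta> * mixture k v)"
          by (rule mult_left_mono[OF True less_imp_le[OF type_factor_pos]])
        finally show ?thesis using True by (simp add: mult.assoc)
      qed (simp add: assms mixture_nonneg less_imp_le[OF type_factor_pos])
    qed
    also have "\<dots> = type_factor * \<eta>"
      by (simp add: sum_mixture flip: sum_distrib_left)
    finally show ?thesis .
  qed
  then have "?prob \<le> (\<Sum>b\<in>paths. type_factor * \<eta>)" by (rule sum_mono)
  then show ?thesis by (simp add: card_paths)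
qed

definition decoding_region :: "real \<Rightarrow> nat \<Rightarrow> (nat \<Rightarrow> nat \<Rightarrow> nat) \<Rightarrow> (nat \<Rightarrow> 'y list) set" where
  "decoding_region \<theta> k \<pi> = {r \<in> outputs.
    \<exists>b\<in>paths. \<theta> * mixture k r < path_likelihood (channel k) b (permute_blocks L \<pi> r)}"

lemma missed_detection_le:
  assumes \<pi>_perm: "\<pi> \<in> block_permutations L m" and \<theta>_nonneg: "0 \<le> \<theta>"
  shows "(\<Sum>r\<in>outputs - decoding_region \<theta> k \<pi>. receiver_law k (permute_blocks L \<pi> r))
    \<le> tail_prob W1 W2 S L m P h xx k \<gamma> + real S ^ L * (type_factor * (exp (- \<gamma>) * \<theta>))"
proof -
  let ?w = "path_likelihood (channel k)" and ?Q = "memoryless_law (channel k)"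
  let ?missed = "\<lambda>v. \<forall>b\<in>paths. ?w b v \<le> \<theta> * mixture k v"
  have "?missed (permute_blocks L \<pi> r) \<longleftrightarrow> r \<notin> decoding_region \<theta> k \<pi>" if "r \<in> outputs" for r
    using that by (simp add: decoding_region_def mixture_permute_blocks[OF \<pi>_perm] not_less)
  then have "outputs - decoding_region \<theta> k \<pi> = outputs \<inter> {r. ?missed (permute_blocks L \<pi> r)}"
    by blast
  then have "(\<Sum>r\<in>outputs - decoding_region \<theta> k \<pi>. receiver_law k (permute_blocks L \<pi> r))
      = (\<Sum>r\<in>outputs. receiver_law k (permute_blocks L \<pi> r)
          * of_bool (?missed (permute_blocks L \<pi> r)))"
    by (simp add: finite_block_space)
  also have "\<dots> = (\<Sum>v\<in>outputs. \<Sum>b\<in>paths. receiver_path_law k b v * of_bool (?missed v))"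
    unfolding sum_permute_blocks[OF \<pi>_perm, of "\<lambda>v. receiver_law k v * of_bool (?missed v)"]
    by (simp only: receiver_law_def sum_distrib_right)
  also have "\<dots> = (\<Sum>b\<in>paths. \<Sum>v\<in>outputs. receiver_path_law k b v * of_bool (?missed v))"
    by (rule sum.swap)
  also have "\<dots> \<le> (\<Sum>b\<in>paths. \<Sum>v\<in>outputs. receiver_path_law k b v * of_bool (?w b v \<le> exp \<gamma> * ?Q b v)
      + receiver_path_law k b v * of_bool (?Q b v \<le> exp (- \<gamma>) * \<theta> * mixture k v))"
    unfolding distrib_left[symmetric]
  proof (intro sum_mono mult_left_mono receiver_path_law_nonneg)
    fix b v assume b_path: "b \<in> paths"
    have "?w b v \<le> exp \<gamma> * ?Q b v \<or> ?Q b v \<le> exp (- \<gamma>) * \<theta> * mixture k v"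
      if "?w b v \<le> \<theta> * mixture k v"
    proof -
      have "exp \<gamma> * ?Q b v \<le> \<theta> * mixture k v \<Longrightarrow> ?Q b v \<le> exp (- \<gamma>) * \<theta> * mixture k v"
        by (simp add: exp_minus field_simps)
      then show ?thesis using that by linarith
    qed
    then show "of_bool (?missed v) \<le> (of_bool (?w b v \<le> exp \<gamma> * ?Q b v)
        + of_bool (?Q b v \<le> exp (- \<gamma>) * \<theta> * mixture k v) :: real)"
      using b_path by auto
  qed
  also have "\<dots> \<le> tail_prob W1 W2 S L m P h xx k \<gamma>
      + real S ^ L * (type_factor * (exp (- \<gamma>) * \<theta>))"
    unfolding sum.distrib using \<theta>_nonneg
    by (intro add_mono low_likelihood_prob_le large_mixture_prob_le) simp
  finally show ?thesis .
qed

text \<open>The receiver does not know the path and tests all \<open>S ^ L\<close> of them.\<close>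

lemma false_alarm_le:
  assumes \<rho>_perm: "\<rho> \<in> block_permutations L m" and \<theta>_pos: "0 < \<theta>"
  shows "(\<Sum>\<pi>\<in>block_permutations L m. \<Sum>r\<in>decoding_region \<theta> k \<rho>.
      receiver_law k (permute_blocks L \<pi> r))
    \<le> real (card (block_permutations L m)) * (real S ^ L / \<theta>)"
proof -
  let ?w = "\<lambda>b r. path_likelihood (channel k) b (permute_blocks L \<rho> r)"
  have w_nonneg: "0 \<le> ?w b r" for b r by (rule path_likelihood_nonneg[OF stochastic_channel])
  have "(\<Sum>r\<in>decoding_region \<theta> k \<rho>. mixture k r)
      \<le> (\<Sum>r\<in>decoding_region \<theta> k \<rho>. (\<Sum>b\<in>paths. ?w b r) / \<theta>)"
  proof (rule sum_mono)
    fix r assume "r \<in> decoding_region \<theta> k \<rho>"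
    then obtain b where b_accepts: "b \<in> paths" "\<theta> * mixture k r < ?w b r"
      by (auto simp: decoding_region_def)
    have "?w b r \<le> (\<Sum>b\<in>paths. ?w b r)"
      using b_accepts(1) by (intro member_le_sum finite_paths w_nonneg)
    then show "mixture k r \<le> (\<Sum>b\<in>paths. ?w b r) / \<theta>"
      using b_accepts(2) \<theta>_pos by (simp add: field_simps)
  qed
  also have "\<dots> \<le> (\<Sum>r\<in>outputs. (\<Sum>b\<in>paths. ?w b r) / \<theta>)"
    using \<theta>_pos by (intro sum_mono2 finite_block_space divide_nonneg_pos sum_nonneg w_nonneg)
      (auto simp: decoding_region_def)
  also have "\<dots> = (\<Sum>b\<in>paths. \<Sum>r\<in>outputs. ?w b r) / \<theta>"
    by (simp add: sum_divide_distrib[symmetric] sum.swap[of _ paths])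
  also have "\<dots> = real S ^ L / \<theta>"
    by (simp add: sum_permute_blocks[OF \<rho>_perm, of "path_likelihood (channel k) _"]
        sum_path_likelihood[OF stochastic_channel] card_paths)
  finally show ?thesis
    unfolding sum_permute_blocks_eq_symmetrize mixture_def by (intro mult_left_mono) auto
qed

subsubsection \<open>Permuted encoders\<close>

definition permute_pair ::
  "(nat \<Rightarrow> nat \<Rightarrow> nat) \<Rightarrow> (nat \<Rightarrow> 'y list) \<times> (nat \<Rightarrow> 'y list) \<Rightarrow> (nat \<Rightarrow> 'y list) \<times> (nat \<Rightarrow> 'y list)" where
  "permute_pair \<pi> = map_prod (permute_blocks L \<pi>) (permute_blocks L \<pi>)"

text \<open>The path is computed from the outputs with the permutations undone, so these have the law
  \<open>joint_law\<close> for every \<open>\<pi>\<close>.\<close>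

definition corrected_path :: "(nat \<Rightarrow> nat \<Rightarrow> nat) \<Rightarrow> 'y list \<Rightarrow> 'y list \<Rightarrow> nat \<Rightarrow> nat" where
  "corrected_path \<pi> y1 y2 = path_of (permute_pair \<pi> (blocks_of L m y1, blocks_of L m y2))"

definition permuted_word :: "nat \<Rightarrow> (nat \<Rightarrow> nat \<Rightarrow> nat) \<Rightarrow> (nat \<Rightarrow> nat) \<Rightarrow> 'x list" where
  "permuted_word n \<pi> b
    = block_prefix (\<lambda>l. permute_list (inv (\<pi> l)) (xx l (b l))) (Suc L) @ replicate n undefined"

definition permuted_encoder :: "nat \<Rightarrow> (nat \<Rightarrow> nat \<Rightarrow> nat) \<Rightarrow> nat \<Rightarrow> 'y list \<Rightarrow> 'y list \<Rightarrow> 'x" where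
  "permuted_encoder n \<pi> i y1 y2 = permuted_word n \<pi> (corrected_path \<pi> y1 y2) ! (i - 1)"

lemma permute_pair_in: "\<omega> \<in> outputs \<times> outputs \<Longrightarrow> permute_pair \<pi> \<omega> \<in> outputs \<times> outputs"
  by (auto simp: permute_pair_def permute_blocks_in_block_space)

lemma corrected_path_take:
  assumes "l \<in> {1..L}" "(l - 1) * m \<le> i"
  shows "corrected_path \<pi> (take i y1) (take i y2) l = corrected_path \<pi> y1 y2 l"
proof -
  let ?v = "\<lambda>y. permute_blocks L \<pi> (blocks_of L m y)"
  have "j * m \<le> i" if "j \<in> {1..<l}" for j
  proof -
    have "j * m \<le> (l - 1) * m" using that by (intro mult_right_mono) auto
    also note assms(2)
    finally show ?thesis .
  qed
  then have "path_rec (?v (take i y1)) (?v (take i y2)) l = path_rec (?v y1) (?v y2) l"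
    by (intro path_rec_causal) (auto simp: permute_blocks_def blocks_of_take)
  then show ?thesis using assms(1) by (simp add: corrected_path_def path_of_def permute_pair_def)
qed

lemma corrected_path_in_paths:
  assumes "L * m \<le> length y1" "L * m \<le> length y2"
  shows "corrected_path \<pi> y1 y2 \<in> paths"
  unfolding corrected_path_def
  using assms by (intro path_of_in_paths permute_pair_in) (simp add: blocks_of_in_block_space)

lemma length_permuted_blocks:
  assumes "b \<in> paths"
  shows "length (block_prefix (\<lambda>l. permute_list (p l) (xx l (b l))) (Suc L)) = L * m"
  using length_block_prefix[of "Suc L" "\<lambda>l. permute_list (p l) (xx l (b l))" m]
    length_xx_path[OF assms]
  by simp

lemma channel_inputs_permuted_encoder:
  assumes enc: "\<And>i. enc i j = permuted_encoder n \<pi> i"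
    and lengths: "length y1 = L * m + n" "length y2 = L * m + n"
  shows "channel_inputs (L * m + n) enc j y1 y2 = permuted_word n \<pi> (corrected_path \<pi> y1 y2)"
    (is "?inputs = permuted_word n \<pi> ?b")
proof (rule nth_equalityI)
  have b_path: "?b \<in> paths" using lengths by (intro corrected_path_in_paths) auto
  show "length ?inputs = length (permuted_word n \<pi> ?b)"
    by (simp add: channel_inputs_def permuted_word_def length_permuted_blocks[OF b_path])
  fix i assume "i < length ?inputs"
  then have "?inputs ! i = permuted_word n \<pi> (corrected_path \<pi> (take i y1) (take i y2)) ! i"
    by (simp add: channel_inputs_def enc permuted_encoder_def)
  also have "\<dots> = permuted_word n \<pi> ?b ! i"
    unfolding permuted_word_def
    by (rule nth_block_prefix_cong[where m = m, symmetric])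
      (auto simp: corrected_path_take length_xx_path[OF b_path])
  finally show "?inputs ! i = permuted_word n \<pi> ?b ! i" .
qed

lemma prodW_permuted_word:
  assumes \<pi>_perm: "\<pi> \<in> block_permutations L m"
    and b_path: "b \<in> paths" and length_y: "length y = L * m + n"
  shows "prodW W (permuted_word n \<pi> b) y
    = path_likelihood W b (permute_blocks L \<pi> (blocks_of L m y))
      * prodW W (replicate n undefined) (drop (L * m) y)"
proof -
  let ?x = "\<lambda>l. permute_list (inv (\<pi> l)) (xx l (b l))"
  have blocks: "blocks_of L m y \<in> block_space L m"
    using length_y by (simp add: blocks_of_in_block_space)
  have y_split: "y = block_prefix (blocks_of L m y) (Suc L) @ drop (L * m) y"
    by (simp add: block_prefix_blocks_of)
  have length_eq: "length (xx l (b l)) = length (blocks_of L m y l)" if "l \<in> {1..L}" for l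
    using length_block[OF blocks that] length_xx_path[OF b_path that] by simp
  have "prodW W (permuted_word n \<pi> b) y
      = prodW W (block_prefix ?x (Suc L)) (block_prefix (blocks_of L m y) (Suc L))
        * prodW W (replicate n undefined) (drop (L * m) y)"
    unfolding permuted_word_def
    by (subst y_split, rule prodW_append)
      (simp add: length_permuted_blocks[OF b_path] length_block_prefix_block_space[OF blocks])
  also have "prodW W (block_prefix ?x (Suc L)) (block_prefix (blocks_of L m y) (Suc L))
      = (\<Prod>l\<in>{1..L}. prodW W (?x l) (blocks_of L m y l))"
    by (rule prodW_block_prefix) (simp add: length_eq)
  also have "\<dots> = path_likelihood W b (permute_blocks L \<pi> (blocks_of L m y))"
    unfolding path_likelihood_def permute_blocks_def
    using block_permutations_permutes[OF \<pi>_perm] length_block[OF blocks]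
    by (intro prod.cong refl) (simp add: prodW_permute_list length_eq)
  finally show ?thesis .
qed

lemma flf_prob_permuted_encoder:
  assumes enc: "\<And>i. enc i j = permuted_encoder n \<pi> i" and \<pi>_perm: "\<pi> \<in> block_permutations L m"
    and lengths: "length y1 = L * m + n" "length y2 = L * m + n"
  shows "flf_prob W1 W2 (L * m + n) enc j y1 y2
    = joint_law (permute_pair \<pi> (blocks_of L m y1, blocks_of L m y2))
      * prodW W1 (replicate n undefined) (drop (L * m) y1)
      * prodW W2 (replicate n undefined) (drop (L * m) y2)"
proof -
  have b_path: "corrected_path \<pi> y1 y2 \<in> paths"
    using lengths by (intro corrected_path_in_paths) auto
  show ?thesis
    unfolding flf_prob_eq_prodW
      channel_inputs_permuted_encoder[where enc = enc and j = j, OF enc lengths]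
      prodW_permuted_word[OF \<pi>_perm b_path lengths(1)]
      prodW_permuted_word[OF \<pi>_perm b_path lengths(2)]
    by (simp add: joint_law_def corrected_path_def permute_pair_def mult_ac)
qed

lemma sum_flf_prob_permuted_encoder:
  assumes enc: "\<And>i. enc i j = permuted_encoder n \<pi> i" and \<pi>_perm: "\<pi> \<in> block_permutations L m"
  shows "(\<Sum>y1\<in>{ys. length ys = L * m + n}. \<Sum>y2\<in>{ys. length ys = L * m + n}.
      flf_prob W1 W2 (L * m + n) enc j y1 y2 * f (blocks_of L m y1) (blocks_of L m y2))
    = (\<Sum>v1\<in>outputs. \<Sum>v2\<in>outputs. joint_law (permute_pair \<pi> (v1, v2)) * f v1 v2)"
proof -
  let ?Y = "{ys :: 'y list. length ys = L * m + n}" and ?T = "{ys :: 'y list. length ys = n}"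
  let ?p = "\<lambda>W. prodW W (replicate n undefined)"
  let ?F = "\<lambda>v1 v2. joint_law (permute_pair \<pi> (v1, v2)) * f v1 v2"
  have tail: "(\<Sum>t\<in>?T. ?p W1 t) = 1" "(\<Sum>t\<in>?T. ?p W2 t) = 1"
    by (simp_all add: sum_prodW W1 W2)
  have "(\<Sum>y1\<in>?Y. \<Sum>y2\<in>?Y. flf_prob W1 W2 (L * m + n) enc j y1 y2
        * f (blocks_of L m y1) (blocks_of L m y2))
      = (\<Sum>y1\<in>?Y. \<Sum>y2\<in>?Y. ?F (blocks_of L m y1) (blocks_of L m y2)
          * ?p W1 (drop (L * m) y1) * ?p W2 (drop (L * m) y2))"
    by (intro sum.cong refl)
      (simp add: flf_prob_permuted_encoder[where enc = enc and j = j, OF enc \<pi>_perm] mult_ac)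
  also have "\<dots> = (\<Sum>v1\<in>outputs. \<Sum>t1\<in>?T. \<Sum>v2\<in>outputs. \<Sum>t2\<in>?T. ?F v1 v2 * ?p W1 t1 * ?p W2 t2)"
    by (simp only: sum_lists_blocks[where f = "\<lambda>v2 t2. ?F _ v2 * _ * ?p W2 t2"]
        sum_lists_blocks[where f = "\<lambda>v1 t1. \<Sum>v2\<in>outputs. \<Sum>t2\<in>?T. ?F v1 v2 * ?p W1 t1 * ?p W2 t2"])
  also have "\<dots> = (\<Sum>v1\<in>outputs. (\<Sum>v2\<in>outputs. ?F v1 v2) * (\<Sum>t1\<in>?T. ?p W1 t1))"
    by (simp only: sum_distrib_left[symmetric] tail mult_1_right sum_distrib_right[symmetric])
  finally show ?thesis by (simp add: tail)
qed

lemma sum_joint_law_permute_pair: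
  assumes \<pi>_perm: "\<pi> \<in> block_permutations L m"
  shows "(\<Sum>\<omega>\<in>outputs \<times> outputs. joint_law (permute_pair \<pi> \<omega>) * f (output_of k \<omega>))
    = (\<Sum>r\<in>outputs. receiver_law k (permute_blocks L \<pi> r) * f r)"
proof -
  define g where "g v = f (permute_blocks L (\<lambda>l. inv (\<pi> l)) v)" for v
  have g_permute: "g (permute_blocks L \<pi> r) = f r" if "r \<in> outputs" for r
    using that by (simp add: g_def permute_blocks_inv[OF \<pi>_perm])
  have "(\<Sum>\<omega>\<in>outputs \<times> outputs. joint_law (permute_pair \<pi> \<omega>) * f (output_of k \<omega>))
      = (\<Sum>\<omega>\<in>outputs \<times> outputs. joint_law (permute_pair \<pi> \<omega>) * g (output_of k (permute_pair \<pi> \<omega>)))"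
    by (intro sum.cong refl) (auto simp: g_permute output_of_def permute_pair_def)
  also have "\<dots> = (\<Sum>\<omega>\<in>outputs \<times> outputs. joint_law \<omega> * g (output_of k \<omega>))"
    using bij_betw_map_prod[OF bij_betw_permute_blocks[OF \<pi>_perm]
      bij_betw_permute_blocks[OF \<pi>_perm]]
    unfolding permute_pair_def by (rule sum.reindex_bij_betw)
  also have "\<dots> = (\<Sum>v\<in>outputs. receiver_law k v * g v)"
    unfolding sum_receiver_path_law_mult[where f = "\<lambda>_. g", symmetric]
    by (subst sum.swap) (simp add: receiver_law_def sum_distrib_right)
  also have "\<dots> = (\<Sum>r\<in>outputs. receiver_law k (permute_blocks L \<pi> r) * g (permute_blocks L \<pi> r))"
    by (rule sum_permute_blocks[OF \<pi>_perm, symmetric])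
  finally show ?thesis by (simp add: g_permute)
qed

lemma flf_message_err_permuted_encoder:
  assumes enc: "\<And>i. enc i j = permuted_encoder n \<pi> i" and \<pi>_perm: "\<pi> \<in> block_permutations L m"
  shows "flf_message_err W1 W2 (L * m + n) enc k (g \<circ> blocks_of L m) j
    = (\<Sum>r\<in>{r \<in> outputs. g r \<noteq> j}. receiver_law k (permute_blocks L \<pi> r))"
proof -
  have "flf_message_err W1 W2 (L * m + n) enc k (g \<circ> blocks_of L m) j
      = (\<Sum>v1\<in>outputs. \<Sum>v2\<in>outputs.
          joint_law (permute_pair \<pi> (v1, v2)) * of_bool (g (output_of k (v1, v2)) \<noteq> j))"
    unfolding flf_message_err_def
      sum_flf_prob_permuted_encoder[where enc = enc and j = j, OF enc \<pi>_perm, symmetric]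
    by (intro sum.cong refl) (simp add: output_of_def)
  also have "\<dots> = (\<Sum>r\<in>outputs. receiver_law k (permute_blocks L \<pi> r) * of_bool (g r \<noteq> j))"
    using sum_joint_law_permute_pair[OF \<pi>_perm, of "\<lambda>r. of_bool (g r \<noteq> j)" k]
    by (simp only: sum.cartesian_product')
  finally show ?thesis by (simp add: finite_block_space Int_def)
qed

definition codebook_err :: "real \<Rightarrow> (nat \<Rightarrow> nat \<Rightarrow> nat \<Rightarrow> nat) \<Rightarrow> nat \<Rightarrow> nat \<Rightarrow> real" where
  "codebook_err \<theta> c k j = (\<Sum>r\<in>outputs - disjointed (\<lambda>i. decoding_region \<theta> k (c i)) j.
    receiver_law k (permute_blocks L (c j) r))"

definition threshold_decoder ::
  "real \<Rightarrow> (nat \<Rightarrow> nat \<Rightarrow> nat \<Rightarrow> nat) \<Rightarrow> nat \<Rightarrow> (nat \<Rightarrow> 'y list) \<Rightarrow> nat" where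
  "threshold_decoder \<theta> c k r = Suc (LEAST i. r \<in> decoding_region \<theta> k (c i))"

lemma good_codebook_exists:
  assumes \<theta>_pos: "0 < \<theta>" and M_le: "2 * real (M - 1) * (real S ^ L / \<theta>) \<le> \<tau>"
    and tail: "\<And>k. k \<in> {1, 2} \<Longrightarrow> tail_prob W1 W2 S L m P h xx k \<gamma>
      + real S ^ L * (type_factor * (exp (- \<gamma>) * \<theta>)) \<le> \<alpha>"
  shows "\<exists>c. \<forall>j<M. c j \<in> block_permutations L m \<and> (\<forall>k\<in>{1, 2}. codebook_err \<theta> c k j \<le> \<alpha> + \<tau>)"
  unfolding codebook_err_def
proof (rule maximal_codebook[where \<beta> = "real S ^ L / \<theta>"])
  let ?C = "block_permutations L m"
  show "?C \<noteq> {}" using card_block_permutations[of L m] by auto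
  show "(\<Sum>r\<in>outputs - decoding_region \<theta> k d. receiver_law k (permute_blocks L d r)) \<le> \<alpha>"
    if "k \<in> {1, 2}" "d \<in> ?C" for k d
    using missed_detection_le[OF that(2)] tail[OF that(1)] \<theta>_pos by (meson less_imp_le order_trans)
  show "(\<Sum>d\<in>?C. \<Sum>r\<in>outputs \<inter> decoding_region \<theta> k d'. receiver_law k (permute_blocks L d r))
      \<le> real (card ?C) * (real S ^ L / \<theta>)" if "d' \<in> ?C" for k d'
  proof -
    have "outputs \<inter> decoding_region \<theta> k d' = decoding_region \<theta> k d'"
      by (auto simp: decoding_region_def)
    then show ?thesis using false_alarm_le[OF that \<theta>_pos] by simp
  qed
qed (use \<theta>_pos M_le
  in \<open>auto simp: finite_block_space finite_block_permutations receiver_law_nonneg\<close>)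

lemma flf_message_err_threshold_decoder_le:
  assumes enc: "\<And>i. enc i (Suc j) = permuted_encoder n (c j) i"
    and c_perm: "c j \<in> block_permutations L m"
  shows "flf_message_err W1 W2 (L * m + n) enc k (threshold_decoder \<theta> c k \<circ> blocks_of L m) (Suc j)
    \<le> codebook_err \<theta> c k j"
proof -
  have "{r \<in> outputs. threshold_decoder \<theta> c k r \<noteq> Suc j}
      \<subseteq> outputs - disjointed (\<lambda>i. decoding_region \<theta> k (c i)) j"
    by (auto simp: threshold_decoder_def dest: Least_disjointed)
  then show ?thesis
    unfolding codebook_err_def
      flf_message_err_permuted_encoder[where enc = enc and j = "Suc j", OF enc c_perm]
    by (intro sum_mono2) (auto simp: finite_block_space receiver_law_nonneg)
qed

lemma flf_code_exists:
  assumes \<theta>_pos: "0 < \<theta>" and M_bounds: "1 \<le> M" "2 * real (M - 1) * (real S ^ L / \<theta>) \<le> \<tau>"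
    and tail: "\<And>k. k \<in> {1, 2} \<Longrightarrow> tail_prob W1 W2 S L m P h xx k \<gamma>
      + real S ^ L * (type_factor * (exp (- \<gamma>) * \<theta>)) \<le> \<alpha>"
  shows "\<exists>Q g1 g2. flf_code W1 W2 (L * m + n) M (\<alpha> + \<tau>) Q g1 g2"
proof -
  obtain c where c_perm: "\<And>j. j < M \<Longrightarrow> c j \<in> block_permutations L m"
    and c_err: "\<And>j k. j < M \<Longrightarrow> k \<in> {1, 2} \<Longrightarrow> codebook_err \<theta> c k j \<le> \<alpha> + \<tau>"
    using good_codebook_exists[OF \<theta>_pos M_bounds(2) tail] by blast
  define enc where "enc = (\<lambda>i j. permuted_encoder n (c (j - 1)) i)"
  let ?g = "\<lambda>k. threshold_decoder \<theta> c k \<circ> blocks_of L m"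
  have "flf_message_err W1 W2 (L * m + n) enc k (?g k) j \<le> \<alpha> + \<tau>"
    if k_mem: "k \<in> {1, 2}" and "j \<in> {1..M}" for k j
  proof -
    from \<open>j \<in> {1..M}\<close> obtain i where j_eq: "j = Suc i" and i_less: "i < M"
      by (cases j) auto
    have "flf_message_err W1 W2 (L * m + n) enc k (?g k) (Suc i) \<le> codebook_err \<theta> c k i"
      by (rule flf_message_err_threshold_decoder_le)
        (use c_perm i_less in \<open>simp_all add: enc_def\<close>)
    with c_err[OF i_less k_mem] show ?thesis unfolding j_eq by (rule order_trans[rotated])
  qed
  then have "flf_code W1 W2 (L * m + n) M (\<alpha> + \<tau>) (return_pmf enc) (?g 1) (?g 2)"
    using M_bounds(1) by (intro flf_code_deterministic) auto
  then show ?thesis by blast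
qed

lemma ln_Mstar_f_ge:
  assumes S_ge: "1 \<le> S" and m_ge: "1 \<le> m" and \<tau>_pos: "0 < \<tau>"
    and tail: "\<And>k. k \<in> {1, 2} \<Longrightarrow> tail_prob W1 W2 S L m P h xx k \<gamma> + exp (- \<zeta>) \<le> \<alpha>"
  shows "ereal (\<gamma> + (ln (\<tau> / 2) - real S * real L * real CARD('x) * ln (1 + real m)
      - real L * ln (real S) - \<zeta>))
    \<le> ln_ereal (Mstar_f W1 W2 (L * m + n) (\<alpha> + \<tau>))" (is "ereal ?t \<le> _")
proof -
  define \<theta> where "\<theta> = exp (\<gamma> - \<zeta>) / (real S ^ L * type_factor)"
  define M where "M = nat \<lceil>exp ?t\<rceil>"
  have card_pos: "0 < real S ^ L" using S_ge by simp
  have M_bounds: "1 \<le> M" "exp ?t \<le> real M" "real (M - 1) \<le> exp ?t"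
    unfolding M_def by (simp_all add: Suc_le_eq real_nat_ceiling_ge of_nat_diff)
  have "2 * real (M - 1) * (real S ^ L * (real S ^ L * type_factor))
      \<le> 2 * exp ?t * (real S ^ L * (real S ^ L * type_factor))"
    using M_bounds(3) type_factor_pos by (intro mult_right_mono mult_left_mono) auto
  also have "\<dots> \<le> \<tau> * exp (\<gamma> - \<zeta>)"
    unfolding type_factor_def using S_ge m_ge \<tau>_pos by (intro codebook_size_le) auto
  finally have "2 * real (M - 1) * (real S ^ L / \<theta>) \<le> \<tau>"
    by (simp add: \<theta>_def divide_le_eq)
  moreover have "real S ^ L * (type_factor * (exp (- \<gamma>) * \<theta>)) = exp (- \<zeta>)"
    using card_pos type_factor_pos by (simp add: \<theta>_def exp_diff exp_minus field_simps)
  ultimately have "\<exists>Q g1 g2. flf_code W1 W2 (L * m + n) M (\<alpha> + \<tau>) Q g1 g2"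
    using M_bounds(1) card_pos type_factor_pos tail
    by (intro flf_code_exists[where \<theta> = \<theta> and \<gamma> = \<gamma>]) (auto simp: \<theta>_def)
  then have "ereal (ln (real M)) \<le> ln_ereal (Mstar_f W1 W2 (L * m + n) (\<alpha> + \<tau>))"
    using ln_le_ln_ereal_Mstar_f by blast
  moreover have "?t \<le> ln (real M)" using M_bounds(1,2) by (simp add: ln_ge_iff)
  ultimately show ?thesis by (meson ereal_less_eq(3) order_trans)
qed

end

theorem theorem2:
  fixes W1 W2 :: "'x::finite \<Rightarrow> 'y::finite \<Rightarrow> real"
    and S L m nB :: nat
    and P :: "nat \<Rightarrow> 'x \<Rightarrow> real"
    and eps tau zeta :: real
    and h :: "nat \<Rightarrow> 'x list \<Rightarrow> 'y list \<Rightarrow> 'y list \<Rightarrow> nat"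
    and xx :: "nat \<Rightarrow> nat \<Rightarrow> 'x list"
  assumes W1: "stochastic W1" and W2: "stochastic W2"
    and S: "S \<ge> 2" and L: "L \<ge> 1" and m: "m \<ge> 1" and nB: "nB \<ge> 1"
    and P: "\<forall>s\<in>{1..S}. is_type m (P s)"
    and eps: "0 < eps" "eps < 1"
    and tau: "0 < tau" "tau < eps"
    and zeta: "zeta > 0"
    and h: "\<forall>l\<in>{1..L}. \<forall>xs ys1 ys2. length xs = (l - 1) * m \<and> length ys1 = (l - 1) * m
              \<and> length ys2 = (l - 1) * m \<longrightarrow> h l xs ys1 ys2 \<in> {1..S}"
    and xx: "in_F S L m P xx"
  shows "Sup {ereal \<gamma> | \<gamma>. max (tail_prob W1 W2 S L m P h xx 1 \<gamma>) (tail_prob W1 W2 S L m P h xx 2 \<gamma>)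
                          < eps - tau - exp (- zeta)}
         + ereal (ln (tau / 2) - real S * real L * real CARD('x) * ln (1 + real m)
                  - real L * ln (real S) - zeta)
         \<le> ln_ereal (Mstar_f W1 W2 (L * m + nB) (eps + eps_star W1 W2 nB (S ^ L)))"
    (is "Sup ?G + ereal ?c \<le> ?R")
proof -
  interpret feedback_scheme W1 W2 S L m P h xx
    by unfold_locales (use W1 W2 h xx in auto)
  have "g \<le> ?R - ereal ?c" if "g \<in> ?G" for g
  proof -
    from that obtain \<gamma> where g: "g = ereal \<gamma>"
      and \<gamma>: "max (tail_prob W1 W2 S L m P h xx 1 \<gamma>) (tail_prob W1 W2 S L m P h xx 2 \<gamma>)
        < eps - tau - exp (- zeta)"
      by blast
    define \<alpha> where "\<alpha> = eps + eps_star W1 W2 nB (S ^ L) - tau"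
    have "tail_prob W1 W2 S L m P h xx k \<gamma> + exp (- zeta) \<le> \<alpha>" if "k \<in> {1, 2}" for k
      using that \<gamma> eps_star_nonneg[OF W1, of W2 nB "S ^ L"] by (auto simp: \<alpha>_def)
    then have "ereal (\<gamma> + ?c) \<le> ?R"
      using ln_Mstar_f_ge[of tau \<gamma> zeta \<alpha> nB] S m tau(1) by (simp add: \<alpha>_def)
    then show ?thesis by (simp add: g ereal_le_minus)
  qed
  then have "Sup ?G \<le> ?R - ereal ?c" by (rule Sup_least)
  then show ?thesis by (simp add: ereal_le_minus)
qed

end
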